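(* Let $l_1,l_2\ge 1$ be integers, $d=l_1+l_2$, and $\Omega=B_{l_1}\times B_{l_2}\subset\mathbb{C}^d$, where $B_l$ denotes the open Euclidean unit ball of $\mathbb{C}^l$. Let $\phi\colon\Omega\to\Omega$ be a truly $d$-dimensional Schur map inducing a compact composition operator $C_\phi\colon H^2(\Omega)\to H^2(\Omega)$, $C_\phi f=f\circ\phi$. If $\|\phi\|_\infty:=\sup_{z\in\Omega}|||\phi(z)|||<1$, then there exist constants $0<c\le C<\infty$, independent of $n$, such that $$a_n(C_\phi)\le C\,e^{-c\,n^{1/d}}\qquad (n=1,2,\ldots),$$ that is, $\gamma_d^{-}(C_\phi)>0$.
   Context: $\Omega$ is the unit ball of $\mathbb{C}^d$ for the norm $|||z|||=\max\big(\|u\|,\|v\|\big)$ where $z=(u,v)$, $u\in\mathbb{C}^{l_1}$, $v\in\mathbb{C}^{l_2}$ and $\|\cdot\|$ is the Euclidean (hermitian) norm. Its Shilov boundary is $S_{l_1}\times S_{l_2}$ ($S_l$ the unit sphere of $\mathbb{C}^l$), with normalized measure $\sigma=\sigma_{l_1}\otimes\sigma_{l_2}$, $\sigma_l$ the normalized surface measure on $S_l$. The Hardy space $H^2(\Omega)$ is the Hilbert space of holomorphic $f\colon\Omega\to\mathbb{C}$ with $\|f\|^2=\sup_{0<r<1}\int_{S_{l_1}\times S_{l_2}}|f(r\xi)|^2\,d\sigma(\xi)<\infty$. A Schur map is a non-constant holomorphic map $\phi\colon\Omega\to\Omega$; it is truly $d$-dimensional if $\phi'(a)$ is an invertible linear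 map of $\mathbb{C}^d$ for at least one $a\in\Omega$. The approximation numbers of a bounded operator $T$ on a Hilbert space are $a_n(T)=\inf\{\|T-R\|:\operatorname{rank}R<n\}$, and $\gamma_d^{-}(T)=\liminf_{n\to\infty}\frac{\log(1/a_n(T))}{n^{1/d}}$. *)

theory Defs
  imports "HOL-Analysis.Analysis"
begin

text \<open>Points of C^d, d = l1 + l2, are pairs (u,v) with u in C^l1, v in C^l2; the
  dimensions l1, l2 are the cardinalities of the finite index types 'a, 'b.\<close>

type_synonym ('a, 'b) pt = "(complex ^ 'a) \<times> (complex ^ 'b)"

definition Omega :: "('a::finite, 'b::finite) pt set" where
  "Omega = {(u, v). norm u < 1 \<and> norm v < 1}"

definition cscale :: "complex \<Rightarrow> ('a::finite, 'b::finite) pt \<Rightarrow> ('a, 'b) pt" where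
  "cscale c z = (c *s fst z, c *s snd z)"

text \<open>Holomorphic = complex (Frechet) differentiable: real derivative that is complex-linear.\<close>
definition holo_fun :: "('a::finite, 'b::finite) pt set \<Rightarrow> (('a, 'b) pt \<Rightarrow> complex) \<Rightarrow> bool" where
  "holo_fun U f \<longleftrightarrow> (\<forall>z\<in>U. \<exists>D. (f has_derivative D) (at z) \<and>
      (\<forall>x. D (cscale \<i> x) = \<i> * D x))"

definition holo_map :: "('a::finite, 'b::finite) pt set \<Rightarrow> (('a, 'b) pt \<Rightarrow> ('a, 'b) pt) \<Rightarrow> bool" where
  "holo_map U f \<longleftrightarrow> (\<forall>z\<in>U. \<exists>D. (f has_derivative D) (at z) \<and>
      (\<forall>x. D (cscale \<i> x) = cscale \<i> (D x)))"

definition schur_map :: "(('a::finite, 'b::finite) pt \<Rightarrow> ('a, 'b) pt) \<Rightarrow> bool" where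
  "schur_map \<phi> \<longleftrightarrow> holo_map Omega \<phi> \<and> \<phi> ` Omega \<subseteq> Omega \<and>
      \<not> (\<exists>c. \<forall>z\<in>Omega. \<phi> z = c)"

definition truly_d_dim :: "(('a::finite, 'b::finite) pt \<Rightarrow> ('a, 'b) pt) \<Rightarrow> bool" where
  "truly_d_dim \<phi> \<longleftrightarrow> (\<exists>a\<in>Omega. \<exists>D. (\<phi> has_derivative D) (at a) \<and> bij D)"

text \<open>Normalized surface measure on the unit sphere of C^n: radial projection of the
  normalized Lebesgue measure of the unit ball.\<close>
definition sphere_measure :: "(complex ^ 'n::finite) measure" where
  "sphere_measure = distr (uniform_measure lborel (ball 0 1)) borel sgn"

definition shilov_measure :: "('a::finite, 'b::finite) pt measure" where
  "shilov_measure = sphere_measure \<Otimes>\<^sub>M sphere_measure"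

definition hardy_sq :: "(('a::finite, 'b::finite) pt \<Rightarrow> complex) \<Rightarrow> ennreal" where
  "hardy_sq f = (SUP r\<in>{0<..<1::real}.
      \<integral>\<^sup>+ \<xi>. ennreal ((cmod (f (r *\<^sub>R \<xi>)))\<^sup>2) \<partial>shilov_measure)"

definition in_H2 :: "(('a::finite, 'b::finite) pt \<Rightarrow> complex) \<Rightarrow> bool" where
  "in_H2 f \<longleftrightarrow> holo_fun Omega f \<and> hardy_sq f < \<infinity>"

definition hardy_norm :: "(('a::finite, 'b::finite) pt \<Rightarrow> complex) \<Rightarrow> real" where
  "hardy_norm f = sqrt (enn2real (hardy_sq f))"

type_synonym ('a, 'b) h2op = "(('a, 'b) pt \<Rightarrow> complex) \<Rightarrow> (('a, 'b) pt \<Rightarrow> complex)"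

definition comp_op :: "(('a::finite, 'b::finite) pt \<Rightarrow> ('a, 'b) pt) \<Rightarrow> ('a, 'b) h2op" where
  "comp_op \<phi> f = f \<circ> \<phi>"

definition op_norm :: "('a::finite, 'b::finite) h2op \<Rightarrow> ereal" where
  "op_norm T = (SUP f\<in>{f. in_H2 f \<and> hardy_norm f \<le> 1}. ereal (hardy_norm (T f)))"

text \<open>T is a well-defined (on H^2 elements, i.e. restrictions to Omega) map H^2 to H^2.\<close>
definition H2_map :: "('a::finite, 'b::finite) h2op \<Rightarrow> bool" where
  "H2_map T \<longleftrightarrow> (\<forall>f. in_H2 f \<longrightarrow> in_H2 (T f)) \<and>
     (\<forall>f g. in_H2 f \<longrightarrow> in_H2 g \<longrightarrow> (\<forall>z\<in>Omega. f z = g z) \<longrightarrow> (\<forall>z\<in>Omega. T f z = T g z))"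

definition H2_linear :: "('a::finite, 'b::finite) h2op \<Rightarrow> bool" where
  "H2_linear T \<longleftrightarrow> (\<forall>f g a b. in_H2 f \<longrightarrow> in_H2 g \<longrightarrow>
     (\<forall>z\<in>Omega. T (\<lambda>w. a * f w + b * g w) z = a * T f z + b * T g z))"

text \<open>Compact operator: image of the unit ball is relatively compact in (complete) H^2,
  i.e. every bounded sequence has a subsequence whose image is Cauchy.\<close>
definition compact_H2_op :: "('a::finite, 'b::finite) h2op \<Rightarrow> bool" where
  "compact_H2_op T \<longleftrightarrow> H2_map T \<and> H2_linear T \<and>
     (\<forall>F::nat \<Rightarrow> (('a, 'b) pt \<Rightarrow> complex). (\<forall>k. in_H2 (F k) \<and> hardy_norm (F k) \<le> 1) \<longrightarrow>
        (\<exists>s::nat\<Rightarrow>nat. strict_mono s \<and> (\<forall>e>0. \<exists>N. \<forall>m\<ge>N. \<forall>n\<ge>N.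
            hardy_norm (\<lambda>z. T (F (s m)) z - T (F (s n)) z) < e)))"

definition rank_less :: "nat \<Rightarrow> ('a::finite, 'b::finite) h2op set" where
  "rank_less n = {R. H2_map R \<and> H2_linear R \<and>
     (\<exists>G. finite G \<and> card G < n \<and> (\<forall>g\<in>G. in_H2 g) \<and>
        (\<forall>f. in_H2 f \<longrightarrow> (\<exists>c. \<forall>z\<in>Omega. R f z = (\<Sum>g\<in>G. c g * g z))))}"

definition approx_num :: "('a::finite, 'b::finite) h2op \<Rightarrow> nat \<Rightarrow> ereal" where
  "approx_num T n = (INF R\<in>rank_less n. op_norm (\<lambda>f z. T f z - R f z))"

end

theory Submission
  imports Defs "HOL-Complex_Analysis.Complex_Analysis" "HOL-Real_Asymp.Real_Asymp"
begin

text \<open>Let \<open>T\<close> be the supremum of \<open>|||\<phi>|||\<close> (enlarged to be positive) and \<open>T < \<rho> < 1\<close>.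
  Functions in the unit ball of \<open>H\<^sup>2\<close> are uniformly bounded on \<open>\<rho>\<Omega>\<close>: Cauchy estimates on
  slices, together with the invariance of Lebesgue measure under rotations, bound their values by
  the mean over the Shilov boundary. Expanding \<open>f\<close> into homogeneous parts along complex lines
  through the origin and truncating at degree \<open>m\<close> gives an error \<open>O((T/\<rho>)\<^sup>m)\<close> on \<open>\<phi>(\<Omega>)\<close>.
  By Liouville's theorem the truncation is a polynomial of degree less than \<open>m\<close> in each coordinate,
  so by Lagrange interpolation it is determined linearly by its values at \<open>m\<^sup>d\<close> nodes; composing
  with \<open>\<phi>\<close> yields an approximation of \<open>C\<^sub>\<phi>\<close> of rank at most \<open>m\<^sup>d\<close>.\<close>

subsection \<open>Rotation invariance of Lebesgue measure\<close>

lemma nn_integral_lborel_translate: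
  fixes g :: "'a::euclidean_space \<Rightarrow> ennreal"
  assumes [measurable]: "g \<in> borel_measurable borel"
  shows "(\<integral>\<^sup>+x. g (c + x) \<partial>lborel) = (\<integral>\<^sup>+x. g x \<partial>lborel)"
  by (subst (2) lborel_distr_plus[of c, symmetric]) (simp add: nn_integral_distr)

text \<open>Uniqueness of Haar measure: both sides, multiplied by the volume of the unit ball \<open>B\<close>,
  are the integral of \<open>1\<^sub>B(z) g(y)\<close>, seen through the two shears
  \<open>y \<mapsto> y + A z\<close> and \<open>z \<mapsto> z - A\<inverse> y\<close>.\<close>

lemma nn_integral_lborel_linear_isometry:
  fixes A :: "'a::euclidean_space \<Rightarrow> 'a" and g :: "'a \<Rightarrow> ennreal"
  assumes lin: "linear A" and iso: "\<And>x. norm (A x) = norm x"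
    and [measurable]: "g \<in> borel_measurable borel"
  shows "(\<integral>\<^sup>+x. g (A x) \<partial>lborel) = (\<integral>\<^sup>+x. g x \<partial>lborel)"
proof -
  define B where "B = (\<lambda>x::'a. indicator (ball 0 1) x :: ennreal)"
  define v where "v = (\<integral>\<^sup>+x. B x \<partial>lborel)"
  have [measurable]: "B \<in> borel_measurable borel" unfolding B_def by (rule borel_measurable_indicator) simp
  have [measurable]: "A \<in> borel_measurable borel"
    using lin by (intro borel_measurable_continuous_onI linear_continuous_on)
      (simp add: linear_conv_bounded_linear)
  have Bcong: "B x = B y" if "norm x = norm y" for x y
    using that by (simp add: B_def indicator_def)
  \<comment> \<open>A preimage \<open>A' y\<close> of \<open>y\<close> is what the change of
    variable \<open>z \<mapsto> A' y + z\<close> below requires; in finite dimension it exists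
    because an isometry is injective.\<close>
  have "inj A"
    using lin iso by (metis linear_injective_0 norm_eq_zero)
  then have "surj A"
    by (rule linear_inj_imp_surj[OF lin])
  then obtain A' where A': "\<And>y. A (A' y) = y"
    by (metis surjD)
  have v: "v = emeasure lborel (ball (0::'a) 1)"
    by (simp add: v_def B_def)
  \<comment> \<open>Positivity and finiteness of \<open>v\<close> allow it to be cancelled at the
    end.\<close>
  have v0: "v \<noteq> 0" 
    using content_ball_pos[of 1 "0::'a"] by (auto simp: v measure_def)
  have vfin: "v \<noteq> \<infinity>"
    using emeasure_lborel_ball_finite[of "0::'a" 1] by (simp add: v)
  have "v * (\<integral>\<^sup>+y. g y \<partial>lborel) = (\<integral>\<^sup>+z. B z * (\<integral>\<^sup>+y. g y \<partial>lborel) \<partial>lborel)"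
    by (simp add: v_def nn_integral_multc)
  also have "\<dots> = (\<integral>\<^sup>+z. (\<integral>\<^sup>+y. B z * g (A z + y) \<partial>lborel) \<partial>lborel)"
    by (simp add: nn_integral_cmult nn_integral_lborel_translate)
  also have "\<dots> = (\<integral>\<^sup>+y. (\<integral>\<^sup>+z. B z * g (A z + y) \<partial>lborel) \<partial>lborel)"
    by (rule lborel_pair.Fubini') measurable
  also have "\<dots> = (\<integral>\<^sup>+y. (\<integral>\<^sup>+z. B (A z - y) * g (A z) \<partial>lborel) \<partial>lborel)"
  proof (rule nn_integral_cong)
    fix y
    have "(\<integral>\<^sup>+z. B z * g (A z + y) \<partial>lborel)
        = (\<integral>\<^sup>+z. B (A (A' y + z) - y) * g (A (A' y + z)) \<partial>lborel)"
      using A' by (intro nn_integral_cong arg_cong2[where f="(*)"] Bcong arg_cong[of _ _ g])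
        (simp_all add: linear_add[OF lin] iso)
    also have "\<dots> = (\<integral>\<^sup>+z. B (A z - y) * g (A z) \<partial>lborel)"
      by (rule nn_integral_lborel_translate[where g="\<lambda>z. B (A z - y) * g (A z)"]) measurable
    finally show "(\<integral>\<^sup>+z. B z * g (A z + y) \<partial>lborel) = (\<integral>\<^sup>+z. B (A z - y) * g (A z) \<partial>lborel)" .
  qed
  also have "\<dots> = (\<integral>\<^sup>+z. (\<integral>\<^sup>+y. B (A z - y) * g (A z) \<partial>lborel) \<partial>lborel)"
    by (rule lborel_pair.Fubini'[symmetric]) measurable
  also have "\<dots> = (\<integral>\<^sup>+z. v * g (A z) \<partial>lborel)"
  proof (rule nn_integral_cong)
    fix z
    have "(\<integral>\<^sup>+y. B (A z - y) \<partial>lborel) = (\<integral>\<^sup>+y. B (- A z + y) \<partial>lborel)"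
      by (intro nn_integral_cong Bcong) (simp add: norm_minus_commute)
    also have "\<dots> = v"
      unfolding v_def by (rule nn_integral_lborel_translate) measurable
    finally show "(\<integral>\<^sup>+y. B (A z - y) * g (A z) \<partial>lborel) = v * g (A z)"
      by (simp add: nn_integral_multc)
  qed
  also have "\<dots> = v * (\<integral>\<^sup>+z. g (A z) \<partial>lborel)"
    by (simp add: nn_integral_cmult)
  finally show ?thesis
    using v0 vfin by (simp add: ennreal_mult_cancel_left)
qed

subsection \<open>Estimates on the circle\<close>

lemma Cauchy_integral_unit_circle:
  assumes "g holomorphic_on cball 0 1" "norm z < 1"
  shows "((\<lambda>t. g (cis (2 * pi * t)) * cis (2 * pi * t) / (cis (2 * pi * t) - z)) has_integral g z) {0..1}"
proof -
  have "((\<lambda>u. g u / (u - z)) has_contour_integral (2 * of_real pi * \<i> * g z)) (circlepath 0 1)"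
    using assms by (intro Cauchy_integral_circlepath_simple) auto
  then have "((\<lambda>t. g (cis (2 * pi * t)) / (cis (2 * pi * t) - z) * (2 * pi * \<i> * cis (2 * pi * t)))
      has_integral (2 * of_real pi * \<i> * g z)) {0..1}"
    unfolding has_contour_integral vector_derivative_circlepath
    by (simp add: circlepath cis_conv_exp mult_ac)
  from has_integral_mult_right[OF this, of "1 / (2 * of_real pi * \<i>)"]
  show ?thesis by (simp add: field_simps)
qed

text \<open>Expand the nonnegative integral of \<open>(h t - m)\<^sup>2\<close>, where
  \<open>m\<close> is the mean of \<open>h\<close>; the interval has length 1.\<close>

lemma square_integral_le:
  fixes h :: "real \<Rightarrow> real"
  assumes "continuous_on {0..1} h"
  shows "(integral {0..1} h)\<^sup>2 \<le> integral {0..1} (\<lambda>t. (h t)\<^sup>2)"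
proof -
  define m where "m = integral {0..1} h"
  have h: "(h has_integral m) {0..1}"
    unfolding m_def by (intro integrable_integral integrable_continuous_real assms)
  have h2: "((\<lambda>t. (h t)\<^sup>2) has_integral integral {0..1} (\<lambda>t. (h t)\<^sup>2)) {0..1}"
    by (intro integrable_integral integrable_continuous_real continuous_intros assms)
  have c: "((\<lambda>t. m\<^sup>2) has_integral m\<^sup>2) {0..1::real}"
    using has_integral_const_real[of "m\<^sup>2" 0 1] by simp
  have "((\<lambda>t. (h t)\<^sup>2 - 2 * m * h t + m\<^sup>2) has_integral
      integral {0..1} (\<lambda>t. (h t)\<^sup>2) - 2 * m * m + m\<^sup>2) {0..1}"
    by (intro has_integral_add has_integral_diff h2 c has_integral_mult_right h)
  moreover have "(h t)\<^sup>2 - 2 * m * h t + m\<^sup>2 \<ge> 0" for t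
    using zero_le_power2[of "h t - m"] by (simp add: power2_eq_square algebra_simps)
  ultimately have "0 \<le> integral {0..1} (\<lambda>t. (h t)\<^sup>2) - 2 * m * m + m\<^sup>2"
    by (rule has_integral_nonneg)
  then show ?thesis by (simp add: m_def power2_eq_square)
qed

text \<open>On the circle the Cauchy kernel is at most \<open>1 / (1 - t)\<close> in modulus, and
  \<open>square_integral_le\<close> moves the square inside. The right-hand side is a nonnegative
  Lebesgue integral so that Tonelli applies to it later.\<close>

lemma norm_square_le_circle_mean:
  assumes hol: "g holomorphic_on cball 0 1" and z: "norm z \<le> t" and "t < 1"
  shows "ennreal ((cmod (g z))\<^sup>2) \<le> ennreal (1 / (1 - t)\<^sup>2) *
    (\<integral>\<^sup>+s. ennreal ((cmod (g (cis (2 * pi * s))))\<^sup>2) * indicator {0..1} s \<partial>lborel)"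
proof -
  define h where "h = (\<lambda>s. cmod (g (cis (2 * pi * s))))"
  have conth: "continuous_on {0..1} h"
    unfolding h_def
    by (intro continuous_on_norm continuous_on_compose2[OF holomorphic_on_imp_continuous_on[OF hol]]
        continuous_intros) auto
  have z1: "norm z < 1" using assms by simp
  have I: "((\<lambda>s. h s / (1 - t)) has_integral (integral {0..1} h / (1 - t))) {0..1}"
    by (intro has_integral_divide integrable_integral integrable_continuous_real conth)
  have "cmod (g z) \<le> integral {0..1} h / (1 - t)"
  proof -
    have "cmod (integral {0..1} (\<lambda>s. g (cis (2 * pi * s)) * cis (2 * pi * s) / (cis (2 * pi * s) - z)))
        \<le> integral {0..1} (\<lambda>s. h s / (1 - t))"
    proof (rule integral_norm_bound_integral)
      fix s :: real
      have "1 - t \<le> cmod (cis (2 * pi * s) - z)"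
        using norm_triangle_ineq2[of "cis (2 * pi * s)" z] z by simp
      then show "cmod (g (cis (2 * pi * s)) * cis (2 * pi * s) / (cis (2 * pi * s) - z)) \<le> h s / (1 - t)"
        using \<open>t < 1\<close> by (simp add: h_def norm_mult norm_divide frac_le)
    qed (use I Cauchy_integral_unit_circle[OF hol z1] in \<open>auto simp: has_integral_integrable\<close>)
    then show ?thesis
      using I Cauchy_integral_unit_circle[OF hol z1] by (simp add: integral_unique)
  qed
  then have "(cmod (g z))\<^sup>2 \<le> (integral {0..1} h / (1 - t))\<^sup>2"
    by (rule power_mono) simp
  also have "\<dots> \<le> 1 / (1 - t)\<^sup>2 * integral {0..1} (\<lambda>s. (h s)\<^sup>2)"
    using square_integral_le[OF conth] \<open>t < 1\<close> by (simp add: power_divide divide_right_mono)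
  finally have "ennreal ((cmod (g z))\<^sup>2) \<le> ennreal (1 / (1 - t)\<^sup>2) * ennreal (integral {0..1} (\<lambda>s. (h s)\<^sup>2))"
    by (subst ennreal_mult[symmetric]) (auto intro!: ennreal_leI integral_nonneg integrable_continuous_real continuous_intros conth)
  also have "ennreal (integral {0..1} (\<lambda>s. (h s)\<^sup>2)) =
      (\<integral>\<^sup>+s. ennreal ((h s)\<^sup>2) * indicator {0..1} s \<partial>lborel)"
    by (rule nn_integral_has_integral_lebesgue'[symmetric])
      (auto intro!: integrable_integral integrable_continuous_real continuous_intros conth)
  finally show ?thesis by (simp add: h_def)
qed

text \<open>The substitution \<open>z \<mapsto> U s z\<close> is legitimate for every fixed \<open>s\<close>, so averaging over \<open>s\<close>
  does not change the integral over the invariant set \<open>A\<close>.\<close>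

lemma nn_integral_le_rotation_mean:
  fixes U :: "real \<Rightarrow> 'a::euclidean_space \<Rightarrow> 'a" and g h :: "'a \<Rightarrow> ennreal"
  assumes lin: "\<And>s. linear (U s)" and iso: "\<And>s x. norm (U s x) = norm x"
    and U[measurable]: "(\<lambda>(s, x). U s x) \<in> borel_measurable (borel \<Otimes>\<^sub>M borel)"
    and h[measurable]: "h \<in> borel_measurable borel"
    and A[measurable]: "A \<in> sets borel" and inv: "\<And>s x. U s x \<in> A \<longleftrightarrow> x \<in> A"
    and le: "\<And>x. x \<in> A \<Longrightarrow> g x \<le> K * (\<integral>\<^sup>+s. h (U s x) * indicator {0..1} s \<partial>lborel)"
  shows "(\<integral>\<^sup>+x. g x * indicator A x \<partial>lborel) \<le> K * (\<integral>\<^sup>+x. h x * indicator A x \<partial>lborel)"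
proof -
  \<comment> \<open>Invariance of \<open>A\<close> replaces its indicator at \<open>x\<close> by the
    one at \<open>U s x\<close>, so for fixed \<open>s\<close> the integrand depends on
    \<open>U s x\<close> alone.\<close>
  have "(\<integral>\<^sup>+x. g x * indicator A x \<partial>lborel)
      \<le> (\<integral>\<^sup>+x. K * (\<integral>\<^sup>+s. h (U s x) * indicator A (U s x) * indicator {0..1} s \<partial>lborel) \<partial>lborel)"
    using le by (intro nn_integral_mono) (auto simp: inv indicator_def[of A])
  also have "\<dots> = K * (\<integral>\<^sup>+x. (\<integral>\<^sup>+s. h (U s x) * indicator A (U s x) * indicator {0..1} s \<partial>lborel) \<partial>lborel)"
    by (rule nn_integral_cmult) measurable
  also have "(\<integral>\<^sup>+x. (\<integral>\<^sup>+s. h (U s x) * indicator A (U s x) * indicator {0..1} s \<partial>lborel) \<partial>lborel)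
      = (\<integral>\<^sup>+s. (\<integral>\<^sup>+x. h (U s x) * indicator A (U s x) * indicator {0..1::real} s \<partial>lborel) \<partial>lborel)"
    by (rule lborel_pair.Fubini') measurable
  also have "\<dots> = (\<integral>\<^sup>+s. (\<integral>\<^sup>+x. h x * indicator A x \<partial>lborel) * indicator {0..1::real} s \<partial>lborel)"
    using nn_integral_lborel_linear_isometry[OF lin iso, of "\<lambda>x. h x * indicator A x"]
    by (intro nn_integral_cong) (auto simp: indicator_def[of "{0..1}"])
  also have "\<dots> = (\<integral>\<^sup>+x. h x * indicator A x \<partial>lborel)"
    by (simp add: nn_integral_cmult)
  finally show ?thesis .
qed


subsection \<open>The Shilov boundary\<close>

text \<open>The norm of the product type is the Euclidean one, so the maximum norm whose unit ball
  is \<open>Omega\<close> needs its own name.\<close>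

definition ptnorm :: "('a::finite, 'b::finite) pt \<Rightarrow> real" where
  "ptnorm z = max (norm (fst z)) (norm (snd z))"

lemma Omega_iff: "z \<in> Omega \<longleftrightarrow> ptnorm z < 1"
  by (cases z) (simp add: Omega_def ptnorm_def)

lemma norm_vector_smult: "norm (c *s (x :: complex ^ 'n::finite)) = cmod c * norm x"
  by (simp add: norm_vec_def norm_mult L2_set_right_distrib)

lemma ptnorm_nonneg [simp]: "0 \<le> ptnorm z"
  by (simp add: ptnorm_def le_max_iff_disj)

lemma ptnorm_cscale: "ptnorm (cscale c z) = cmod c * ptnorm z"
  by (simp add: ptnorm_def cscale_def norm_vector_smult max_mult_distrib_left)

lemma ptnorm_scaleR: "ptnorm (r *\<^sub>R z) = \<bar>r\<bar> * ptnorm z"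
  by (simp add: ptnorm_def max_mult_distrib_left)

lemma ptnorm_triangle: "ptnorm (z + w) \<le> ptnorm z + ptnorm w"
  using norm_triangle_ineq[of "fst z" "fst w"] norm_triangle_ineq[of "snd z" "snd w"]
  by (auto simp: ptnorm_def)

lemma continuous_on_ptnorm [continuous_intros]:
  "continuous_on S f \<Longrightarrow> continuous_on S (\<lambda>x. ptnorm (f x))"
  unfolding ptnorm_def by (intro continuous_intros)

lemma continuous_on_vector_smult [continuous_intros]:
  fixes f :: "_ \<Rightarrow> complex" and g :: "_ \<Rightarrow> complex ^ 'n::finite"
  assumes "continuous_on S f" "continuous_on S g"
  shows "continuous_on S (\<lambda>x. f x *s g x)"
  unfolding vector_scalar_mult_def by (intro continuous_intros assms)

lemma open_Omega: "open (Omega :: ('a::finite, 'b::finite) pt set)"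
proof -
  have "Omega = {z :: ('a, 'b) pt. ptnorm z < 1}" by (auto simp: Omega_iff)
  moreover have "open {z :: ('a, 'b) pt. ptnorm z < 1}"
    by (intro open_Collect_less continuous_intros)
  ultimately show ?thesis by simp
qed

lemma cscale_simps [simp]:
  "cscale 1 z = z" "cscale 0 z = 0" "cscale c 0 = 0"
  "cscale a (cscale b z) = cscale (a * b) z"
  "cscale c (z + w) = cscale c z + cscale c w"
  "cscale c (r *\<^sub>R z) = r *\<^sub>R cscale c z"
  by (auto simp: cscale_def vec_eq_iff prod_eq_iff algebra_simps)

lemma linear_cscale_left: "linear (\<lambda>c. cscale c z)"
  by (intro linearI) (auto simp: cscale_def vec_eq_iff prod_eq_iff algebra_simps)

text \<open>Reduces complex scaling to real scaling and \<open>cscale \<i>\<close>, the two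
  operations that a derivative in \<open>holo_fun\<close> is known to respect.\<close>

lemma cscale_Re_Im: "cscale c z = Re c *\<^sub>R z + Im c *\<^sub>R cscale \<i> z"
  using linear_add[OF linear_cscale_left, of "of_real (Re c)" "Im c *\<^sub>R \<i>" z]
    linear_cmul[OF linear_cscale_left, of "Re c" 1 z] linear_cmul[OF linear_cscale_left, of "Im c" \<i> z]
  by (simp add: scaleR_conv_of_real complex_eq[symmetric] mult.commute)

text \<open>A real linear \<open>D\<close> that commutes with multiplication by \<open>\<i>\<close>
  is complex linear, so \<open>D (cscale x q) = D q * x\<close> and the chain rule gives a complex
  derivative. Every use of one-variable theory passes through such lines.\<close>

lemma holo_fun_line:
  assumes "holo_fun U f"
  shows "(\<lambda>c. f (p + cscale c q)) holomorphic_on {c. p + cscale c q \<in> U}"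
  unfolding holomorphic_on_def field_differentiable_def
proof (intro ballI)
  fix c assume "c \<in> {c. p + cscale c q \<in> U}"
  then obtain D where D: "(f has_derivative D) (at (p + cscale c q))"
      and Di: "\<And>x. D (cscale \<i> x) = \<i> * D x"
    using assms by (auto simp: holo_fun_def)
  interpret D: bounded_linear D using D by (rule has_derivative_bounded_linear)
  have "D (cscale x q) = (of_real (Re x) + \<i> * of_real (Im x)) * D q" for x
    by (subst cscale_Re_Im) (simp add: D.add D.scaleR Di scaleR_conv_of_real algebra_simps)
  then have "D (cscale x q) = D q * x" for x
    by (simp add: complex_eq[symmetric] mult.commute)
  moreover have "((\<lambda>c. p + cscale c q) has_derivative (\<lambda>x. cscale x q)) (at c)"
    using linear_cscale_left[of q]
    by (auto intro!: derivative_eq_intros linear_imp_has_derivative)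
  from has_derivative_compose[OF this D]
  have "((\<lambda>c. f (p + cscale c q)) has_derivative (\<lambda>x. D (cscale x q))) (at c)" by simp
  ultimately show "\<exists>f'. ((\<lambda>c. f (p + cscale c q)) has_field_derivative f')
      (at c within {c. p + cscale c q \<in> U})"
    by (auto simp: has_field_derivative_def intro: has_derivative_at_withinI)
qed

lemma holo_fun_continuous_on: "holo_fun U f \<Longrightarrow> continuous_on U f"
  unfolding holo_fun_def
  by (meson continuous_at_imp_continuous_on has_derivative_continuous)

section \<open>Sphere and Shilov measures expressed by Lebesgue integrals over balls\<close>

abbreviation ballvol :: "'a::finite itself \<Rightarrow> ennreal" where
  "ballvol _ \<equiv> emeasure lborel (ball (0 :: complex ^ 'a::finite) 1)"

lemma ballvol: "ballvol TYPE('a::finite) \<noteq> 0" "ballvol TYPE('a) \<noteq> \<infinity>"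
  using content_ball_pos[of 1 "0 :: complex ^ 'a"] emeasure_lborel_ball_finite[of "0 :: complex ^ 'a" 1]
  by (auto simp: measure_def)

text \<open>Unfolds the radial projection. The normalizing volume is multiplied out, which keeps
  division in \<open>ennreal\<close> away from later calculations.\<close>

lemma nn_integral_sphere_measure:
  fixes g :: "complex ^ 'n::finite \<Rightarrow> ennreal"
  assumes [measurable]: "g \<in> borel_measurable borel"
  shows "ballvol TYPE('n) * (\<integral>\<^sup>+x. g x \<partial>sphere_measure) =
    (\<integral>\<^sup>+x. g (sgn x) * indicator (ball 0 1) x \<partial>lborel)"
proof -
  have "(\<integral>\<^sup>+x. g x \<partial>sphere_measure) =
      (\<integral>\<^sup>+x. g (sgn x) * indicator (ball 0 1) x \<partial>lborel) / ballvol TYPE('n)"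
    unfolding sphere_measure_def by (simp add: nn_integral_distr nn_integral_uniform_measure)
  then show ?thesis
    using mult_divide_eq_ennreal[OF ballvol[where 'a='n, unfolded infinity_ennreal_def]]
    by (simp add: ennreal_times_divide mult.commute[of "ballvol TYPE('n)"])
qed

lemma sets_sphere_measure [measurable_cong, simp]: "sets sphere_measure = sets borel"
  by (simp add: sphere_measure_def)

lemma sets_shilov_measure [measurable_cong, simp]: "sets shilov_measure = sets borel"
  unfolding shilov_measure_def by (simp add: borel_prod[symmetric] cong: sets_pair_measure_cong)

lemma emeasure_sphere_measure: "emeasure (sphere_measure :: (complex ^ 'n::finite) measure) UNIV = 1"
proof -
  have "ballvol TYPE('n) * emeasure (sphere_measure :: (complex ^ 'n) measure) UNIV = ballvol TYPE('n) * 1"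
    using nn_integral_sphere_measure[of "\<lambda>_::complex ^ 'n. 1"]
    by (simp add: sets_eq_imp_space_eq[OF sets_sphere_measure])
  then show ?thesis
    using ballvol[where 'a='n] by (simp only: ennreal_mult_cancel_left) auto
qed

lemma sigma_finite_sphere_measure: "sigma_finite_measure (sphere_measure :: (complex ^ 'n::finite) measure)"
proof -
  have "finite_measure (sphere_measure :: (complex ^ 'n) measure)"
    by (rule finite_measureI)
      (simp add: emeasure_sphere_measure sets_eq_imp_space_eq[OF sets_sphere_measure])
  then show ?thesis by (rule finite_measure.axioms)
qed

text \<open>\<open>sgn\<close> has norm 1 except at the origin, where it is 0; with
  \<open>\<le>\<close> both cases are covered.\<close>

lemma AE_sphere_measure: "AE x in sphere_measure. norm x \<le> 1"
  unfolding sphere_measure_def by (subst AE_distr_iff) (auto simp: norm_sgn)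

lemma AE_shilov_measure: "AE \<xi> in (shilov_measure :: ('a::finite, 'b::finite) pt measure). ptnorm \<xi> \<le> 1"
proof -
  interpret pair_sigma_finite "sphere_measure :: (complex ^ 'a) measure"
      "sphere_measure :: (complex ^ 'b) measure"
    by (intro pair_sigma_finite.intro sigma_finite_sphere_measure)
  have [measurable]: "{\<xi> :: ('a, 'b) pt. ptnorm \<xi> \<le> 1} \<in> sets borel"
    by (intro borel_closed closed_Collect_le continuous_intros)
  have "AE x in sphere_measure. AE y in sphere_measure. ptnorm (x, y) \<le> 1"
    using AE_sphere_measure AE_sphere_measure by (auto simp: ptnorm_def)
  then show ?thesis
    unfolding shilov_measure_def
    by (intro AE_pair_measure)
      (simp_all only: shilov_measure_def[symmetric] sets_shilov_measure
        sets_eq_imp_space_eq[OF sets_shilov_measure] space_borel UNIV_I simp_thms \<open>_ \<in> sets borel\<close>)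
qed

text \<open>Apply the sphere formula in each factor and Tonelli; \<open>Omega\<close> is the product
  of the two balls. Means over the Shilov boundary thereby become Lebesgue integrals, for which
  rotation invariance is available.\<close>

lemma nn_integral_shilov_measure:
  fixes g :: "('a::finite, 'b::finite) pt \<Rightarrow> ennreal"
  assumes [measurable]: "g \<in> borel_measurable borel"
  shows "ballvol TYPE('a) * ballvol TYPE('b) * (\<integral>\<^sup>+\<xi>. g \<xi> \<partial>shilov_measure) =
    (\<integral>\<^sup>+z. g (sgn (fst z), sgn (snd z)) * indicator Omega z \<partial>lborel)"
proof -
  interpret sigma_finite_measure "sphere_measure :: (complex ^ 'b::finite) measure"
    by (rule sigma_finite_sphere_measure)
  have [measurable]: "ball (0 :: complex ^ 'b) 1 \<in> sets borel" by simp
  have [measurable]: "g \<in> borel_measurable (borel \<Otimes>\<^sub>M borel)" by (simp add: borel_prod)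
  have [measurable]: "(Omega :: ('a, 'b) pt set) \<in> sets (borel \<Otimes>\<^sub>M borel)"
    using borel_open[OF open_Omega] by (simp only: borel_prod)
  have "ballvol TYPE('a) * ballvol TYPE('b) * (\<integral>\<^sup>+\<xi>. g \<xi> \<partial>shilov_measure)
      = ballvol TYPE('a) * (ballvol TYPE('b) * (\<integral>\<^sup>+x. \<integral>\<^sup>+y. g (x, y) \<partial>sphere_measure \<partial>sphere_measure))"
    unfolding shilov_measure_def by (subst nn_integral_fst) (simp_all add: mult.assoc)
  also have "\<dots> = ballvol TYPE('a) * (\<integral>\<^sup>+x. ballvol TYPE('b) * (\<integral>\<^sup>+y. g (x, y) \<partial>sphere_measure) \<partial>sphere_measure)"
    by (subst nn_integral_cmult) auto
  also have "\<dots> = ballvol TYPE('a) * (\<integral>\<^sup>+x. (\<integral>\<^sup>+y. g (x, sgn y) * indicator (ball 0 1) y \<partial>lborel) \<partial>sphere_measure)"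
    by (subst nn_integral_sphere_measure) auto
  also have "\<dots> = (\<integral>\<^sup>+x. (\<integral>\<^sup>+y. g (sgn x, sgn y) * indicator (ball 0 1) y \<partial>lborel) * indicator (ball 0 1) x \<partial>lborel)"
    by (rule nn_integral_sphere_measure) measurable
  also have "\<dots> = (\<integral>\<^sup>+x. (\<integral>\<^sup>+y. g (sgn x, sgn y) * indicator Omega (x, y) \<partial>lborel) \<partial>lborel)"
    by (intro nn_integral_cong) (auto simp: indicator_def Omega_def intro!: nn_integral_cong)
  also have "\<dots> = (\<integral>\<^sup>+z. g (sgn (fst z), sgn (snd z)) * indicator Omega z \<partial>(lborel \<Otimes>\<^sub>M lborel))"
    by (subst lborel.nn_integral_fst[symmetric]) auto
  finally show ?thesis by (simp add: lborel_prod)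
qed

text \<open>The Shilov measure has mass 1, and \<open>r *\<^sub>R \<xi>\<close> lies in
  \<open>Omega\<close> for almost every \<open>\<xi>\<close>. Uniform estimates on
  \<open>Omega\<close> thus yield estimates of operator norms.\<close>

lemma hardy_sq_le:
  fixes h :: "('a::finite, 'b::finite) pt \<Rightarrow> complex"
  assumes "\<And>z. z \<in> Omega \<Longrightarrow> cmod (h z) \<le> e"
  shows "hardy_sq h \<le> ennreal (e\<^sup>2)"
  unfolding hardy_sq_def
proof (rule SUP_least)
  fix r :: real assume r: "r \<in> {0<..<1}"
  have "(\<integral>\<^sup>+\<xi>. ennreal ((cmod (h (r *\<^sub>R \<xi>)))\<^sup>2) \<partial>shilov_measure) \<le> (\<integral>\<^sup>+\<xi>. ennreal (e\<^sup>2) \<partial>(shilov_measure :: ('a, 'b) pt measure))"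
  proof (rule nn_integral_mono_AE)
    show "AE \<xi> in shilov_measure. ennreal ((cmod (h (r *\<^sub>R \<xi>)))\<^sup>2) \<le> ennreal (e\<^sup>2)"
      using AE_shilov_measure
    proof eventually_elim
      case (elim \<xi>)
      then have "r * ptnorm \<xi> < 1" using r by (smt (verit) greaterThanLessThan_iff mult_left_le)
      then have "cmod (h (r *\<^sub>R \<xi>)) \<le> e"
        using r by (intro assms) (simp add: Omega_iff ptnorm_scaleR)
      then show ?case by (intro ennreal_leI power_mono) auto
    qed
  qed
  also have "\<dots> = ennreal (e\<^sup>2)"
  proof -
    interpret sigma_finite_measure "sphere_measure :: (complex ^ 'b) measure"
      by (rule sigma_finite_sphere_measure)
    have "emeasure (shilov_measure :: ('a, 'b) pt measure) (UNIV \<times> UNIV) = 1"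
      unfolding shilov_measure_def by (subst emeasure_pair_measure_Times) (simp_all add: emeasure_sphere_measure)
    then show ?thesis by (simp add: sets_eq_imp_space_eq[OF sets_shilov_measure])
  qed
  finally show "(\<integral>\<^sup>+\<xi>. ennreal ((cmod (h (r *\<^sub>R \<xi>)))\<^sup>2) \<partial>shilov_measure) \<le> ennreal (e\<^sup>2)" .
qed

lemma hardy_norm_le:
  assumes "\<And>z. z \<in> Omega \<Longrightarrow> cmod (h z) \<le> e" "0 \<le> e"
  shows "hardy_norm h \<le> e"
proof -
  have "hardy_norm h \<le> sqrt (enn2real (ennreal (e\<^sup>2)))"
    unfolding hardy_norm_def
    by (intro real_sqrt_le_mono enn2real_mono hardy_sq_le assms(1)) auto
  then show ?thesis using assms(2) by simp
qed


section \<open>Point values inside \<open>Omega\<close> bounded by the Hardy norm\<close>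

lemma borel_measurable_square_on_Omega:
  fixes f :: "('a::finite, 'b::finite) pt \<Rightarrow> complex"
  assumes "holo_fun Omega f"
  shows "(\<lambda>z. ennreal ((cmod (f z))\<^sup>2) * indicator Omega z) \<in> borel_measurable borel"
proof -
  \<comment> \<open>Outside \<open>Omega\<close> the function is arbitrary; the indicator confines
    it to the open set on which it is continuous.\<close>
  have "(\<lambda>z. indicator Omega z *\<^sub>R f z) \<in> borel_measurable borel"
    by (intro borel_measurable_continuous_on_indicator holo_fun_continuous_on assms borel_open open_Omega)
  then have "(\<lambda>z. ennreal ((cmod (indicator Omega z *\<^sub>R f z))\<^sup>2)) \<in> borel_measurable borel"
    by measurable
  also have "(\<lambda>z. ennreal ((cmod (indicator Omega z *\<^sub>R f z))\<^sup>2)) = (\<lambda>z. ennreal ((cmod (f z))\<^sup>2) * indicator Omega z)"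
    by (auto simp: indicator_def)
  finally show ?thesis .
qed

lemma square_le_slice_mean:
  fixes f :: "('a::finite, 'b::finite) pt \<Rightarrow> complex"
  assumes f: "holo_fun Omega f" and line: "\<And>c. cmod c \<le> 1 \<Longrightarrow> p + cscale c q \<in> Omega"
    and c: "cmod c \<le> t" "t < 1"
  shows "ennreal ((cmod (f (p + cscale c q)))\<^sup>2) \<le> ennreal (1 / (1 - t)\<^sup>2) *
    (\<integral>\<^sup>+s. ennreal ((cmod (f (p + cscale (cis (2 * pi * s)) q)))\<^sup>2) * indicator {0..1} s \<partial>lborel)"
proof (rule norm_square_le_circle_mean[OF _ c, of "\<lambda>c. f (p + cscale c q)"])
  show "(\<lambda>c. f (p + cscale c q)) holomorphic_on cball 0 1"
    by (rule holomorphic_on_subset[OF holo_fun_line[OF f]]) (auto intro: line)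
qed

text \<open>Separate phases in the two factors, so that one factor can be averaged while the other
  is fixed; equal phases give \<open>cscale\<close>.\<close>

definition rot :: "complex \<Rightarrow> complex \<Rightarrow> ('a::finite, 'b::finite) pt \<Rightarrow> ('a, 'b) pt" where
  "rot a b z = (a *s fst z, b *s snd z)"

lemma linear_rot: "linear (rot a b)"
  by (intro linearI) (auto simp: rot_def vec_eq_iff algebra_simps)

lemma norm_rot: "cmod a = 1 \<Longrightarrow> cmod b = 1 \<Longrightarrow> norm (rot a b z) = norm z"
  by (simp add: rot_def norm_prod_def norm_vector_smult)

lemma borel_measurable_rot:
  fixes a b :: "real \<Rightarrow> complex"
  assumes "continuous_on UNIV a" "continuous_on UNIV b"
  shows "(\<lambda>(s, z). rot (a s) (b s) z :: ('a::finite, 'b::finite) pt) \<in> borel_measurable (borel \<Otimes>\<^sub>M borel)"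
proof -
  have "continuous_on UNIV (\<lambda>x. rot (a (fst x)) (b (fst x)) (snd x) :: ('a, 'b) pt)"
    unfolding rot_def
    by (intro continuous_intros continuous_on_compose2[OF assms(1)] continuous_on_compose2[OF assms(2)]) auto
  then show ?thesis
    unfolding borel_prod case_prod_beta' by (rule borel_measurable_continuous_onI)
qed

lemma continuous_on_circle: "continuous_on UNIV (\<lambda>s. cis (2 * pi * s))"
  by (intro continuous_intros)

lemma norm_scaleR_sgn: "norm x *\<^sub>R sgn x = (x :: 'a::real_normed_vector)"
  by (cases "x = 0") (simp_all add: sgn_div_norm)

lemma sgn_unit_smult: "cmod c = 1 \<Longrightarrow> sgn (c *s x) = c *s sgn (x :: complex ^ 'n::finite)"
  by (auto simp: sgn_div_norm norm_vector_smult vec_eq_iff)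

lemma smult_of_real: "of_real r *s x = r *\<^sub>R (x :: complex ^ 'n::finite)"
  unfolding vec_eq_iff vector_smult_component vector_scaleR_component
  by (simp add: scaleR_conv_of_real[where 'a=complex])

text \<open>The two Cauchy estimates, one in each factor, move the mean over the Shilov boundary
  to the interior.\<close>

lemma nn_integral_square_interior_le:
  fixes f :: "('a::finite, 'b::finite) pt \<Rightarrow> complex"
  assumes f: "holo_fun Omega f" and r: "0 < r" "r < 1" and t: "0 < t" "t < 1"
  defines "G \<equiv> \<lambda>z. ennreal ((cmod (f (r *\<^sub>R z)))\<^sup>2) * indicator Omega (r *\<^sub>R z)"
  defines "K \<equiv> ennreal (1 / (1 - t)\<^sup>2)"
  shows "(\<integral>\<^sup>+z. G z * indicator {z. ptnorm z < t} z \<partial>lborel) \<le>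
    K * (K * (ballvol TYPE('a) * ballvol TYPE('b) * hardy_sq f))"
proof -
  \<comment> \<open>\<open>G1\<close> pushes the second component to its sphere, \<open>G2\<close>
    both. The first estimate needs \<open>norm (snd z) < t\<close>, the second needs
    \<open>norm (fst z) < t\<close>; \<open>A1\<close> drops the former restriction, which is spent
    once the first estimate is done.\<close>
  define G1 where "G1 = (\<lambda>z. G (fst z, sgn (snd z)))"
  define G2 where "G2 = (\<lambda>z. G (sgn (fst z), sgn (snd z)))"
  define A1 where "A1 = {z :: ('a, 'b) pt. norm (fst z) < t \<and> norm (snd z) < 1}"
  define A2 where "A2 = {z :: ('a, 'b) pt. ptnorm z < t}"
  have G[measurable]: "G \<in> borel_measurable borel"
  proof -
    have "(\<lambda>z. r *\<^sub>R z :: ('a, 'b) pt) \<in> borel_measurable borel" by measurable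
    from measurable_compose[OF this borel_measurable_square_on_Omega[OF f]]
    show ?thesis by (simp add: G_def)
  qed
  have [measurable]: "G \<in> borel_measurable (borel \<Otimes>\<^sub>M borel)" using G by (simp only: borel_prod)
  have G1[measurable]: "G1 \<in> borel_measurable borel" 
    unfolding G1_def borel_prod[symmetric] by measurable
  have G2[measurable]: "G2 \<in> borel_measurable borel" 
    unfolding G2_def borel_prod[symmetric] by measurable
  have A1[measurable]: "A1 \<in> sets borel"
    unfolding A1_def by (intro borel_open open_Collect_conj open_Collect_less continuous_intros)
  have A2[measurable]: "A2 \<in> sets borel"
    unfolding A2_def by (intro borel_open open_Collect_less continuous_intros)
  \<comment> \<open>The disc may touch the boundary of \<open>Omega\<close>, because
    \<open>G\<close> evaluates \<open>f\<close> after dilation by \<open>r < 1\<close>.\<close>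
  have slice: "G (p + cscale c q) \<le> K * (\<integral>\<^sup>+s. G (p + cscale (cis (2 * pi * s)) q) * indicator {0..1} s \<partial>lborel)"
    if line: "\<And>c. cmod c \<le> 1 \<Longrightarrow> ptnorm (p + cscale c q) \<le> 1" and c: "cmod c \<le> t" for p q :: "('a, 'b) pt" and c
  proof -
    have line': "r *\<^sub>R p + cscale c (r *\<^sub>R q) \<in> Omega" if "cmod c \<le> 1" for c
    proof -
      have "r * ptnorm (p + cscale c q) < 1"
        using line[OF that] r by (smt (verit) mult_left_le)
      then show ?thesis
        using r by (simp add: Omega_iff ptnorm_scaleR scaleR_add_right[symmetric])
    qed
    have eq: "G (p + cscale c q) = ennreal ((cmod (f (r *\<^sub>R p + cscale c (r *\<^sub>R q))))\<^sup>2)" if "cmod c \<le> 1" for c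
      using line'[OF that] by (simp add: G_def scaleR_add_right)
    show ?thesis
      using square_le_slice_mean[OF f line' c t(2)] c t by (simp add: eq K_def)
  qed
  have "(\<integral>\<^sup>+z. G z * indicator A2 z \<partial>lborel) \<le> K * (\<integral>\<^sup>+z. G1 z * indicator A2 z \<partial>lborel)"
  proof (rule nn_integral_le_rotation_mean[where U="\<lambda>s. rot 1 (cis (2 * pi * s))"])
    fix z assume z: "z \<in> A2"
    \<comment> \<open>The point \<open>z\<close> sits at parameter \<open>norm (snd z) < t\<close>
      on the disc in direction \<open>sgn (snd z)\<close>, whose boundary circle is the orbit of the
      rotations averaged over.\<close>
    have "G ((fst z, 0) + cscale (of_real (norm (snd z))) (0, sgn (snd z)))
      \<le> K * (\<integral>\<^sup>+s. G ((fst z, 0) + cscale (cis (2 * pi * s)) (0, sgn (snd z))) * indicator {0..1} s \<partial>lborel)"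
      using z t by (intro slice) (auto simp: A2_def ptnorm_def cscale_def norm_vector_smult norm_sgn)
    then show "G z \<le> K * (\<integral>\<^sup>+s. G1 (rot 1 (cis (2 * pi * s)) z) * indicator {0..1} s \<partial>lborel)"
      by (simp add: cscale_def G1_def rot_def smult_of_real norm_scaleR_sgn sgn_unit_smult)
  qed (rule linear_rot, simp add: norm_rot,
      (rule borel_measurable_rot; intro continuous_on_circle continuous_on_const), rule G1, rule A2,
      simp add: A2_def ptnorm_def rot_def norm_vector_smult)
  also have "\<dots> \<le> K * (\<integral>\<^sup>+z. G1 z * indicator A1 z \<partial>lborel)"
    using t by (intro mult_left_mono nn_integral_mono) (auto simp: indicator_def A1_def A2_def ptnorm_def)
  also have "(\<integral>\<^sup>+z. G1 z * indicator A1 z \<partial>lborel) \<le> K * (\<integral>\<^sup>+z. G2 z * indicator A1 z \<partial>lborel)"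
  proof (rule nn_integral_le_rotation_mean[where U="\<lambda>s. rot (cis (2 * pi * s)) 1"])
    fix z assume z: "z \<in> A1"
    have "G ((0, sgn (snd z)) + cscale (of_real (norm (fst z))) (sgn (fst z), 0))
      \<le> K * (\<integral>\<^sup>+s. G ((0, sgn (snd z)) + cscale (cis (2 * pi * s)) (sgn (fst z), 0)) * indicator {0..1} s \<partial>lborel)"
      using z t by (intro slice) (auto simp: A1_def ptnorm_def cscale_def norm_vector_smult norm_sgn)
    then show "G1 z \<le> K * (\<integral>\<^sup>+s. G2 (rot (cis (2 * pi * s)) 1 z) * indicator {0..1} s \<partial>lborel)"
      by (simp add: cscale_def G1_def G2_def rot_def smult_of_real norm_scaleR_sgn sgn_unit_smult)
  qed (rule linear_rot, simp add: norm_rot,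
      (rule borel_measurable_rot; intro continuous_on_circle continuous_on_const), rule G2, rule A1,
      simp add: A1_def ptnorm_def rot_def norm_vector_smult)
  also have "(\<integral>\<^sup>+z. G2 z * indicator A1 z \<partial>lborel) \<le> (\<integral>\<^sup>+z. G2 z * indicator Omega z \<partial>lborel)"
    using t by (intro nn_integral_mono) (auto simp: indicator_def A1_def Omega_iff ptnorm_def)
  also have "\<dots> = ballvol TYPE('a) * ballvol TYPE('b) * (\<integral>\<^sup>+\<xi>. G \<xi> \<partial>shilov_measure)"
    unfolding G2_def by (rule nn_integral_shilov_measure[symmetric]) measurable
  also have "(\<integral>\<^sup>+\<xi>. G \<xi> \<partial>shilov_measure) \<le> (\<integral>\<^sup>+\<xi>. ennreal ((cmod (f (r *\<^sub>R \<xi>)))\<^sup>2) \<partial>shilov_measure)"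
    by (intro nn_integral_mono) (auto simp: G_def indicator_def)
  also have "\<dots> \<le> hardy_sq f"
    unfolding hardy_sq_def using r by (intro SUP_upper) auto
  finally show ?thesis
    by (simp add: A2_def mult_left_mono)
qed

text \<open>By the sub-mean value property \<open>(cmod (f w))\<^sup>2\<close> is at most the
  average of \<open>G\<close> over a neighbourhood of \<open>w'\<close>, where
  \<open>r *\<^sub>R w' = w\<close>. That neighbourhood lies in the region controlled by
  \<open>nn_integral_square_interior_le\<close>. The constant depends on \<open>\<rho>\<close> and
  the dimensions only.\<close>

lemma in_H2_point_bound:
  assumes "0 < \<rho>" "\<rho> < 1"
  obtains C where "0 \<le> C" "\<And>f w. in_H2 (f :: ('a::finite, 'b::finite) pt \<Rightarrow> complex) \<Longrightarrow> ptnorm w \<le> \<rho> \<Longrightarrow> cmod (f w) \<le> C * hardy_norm f"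
proof -
  \<comment> \<open>With \<open>r = sqrt \<rho>\<close> the rescaled point satisfies
    \<open>ptnorm w' \<le> r < t\<close>, and \<open>\<delta> = t - r\<close> is the room left
    around it.\<close>
  define r where "r = sqrt \<rho>"
  define t where "t = (1 + r) / 2"
  define \<delta> where "\<delta> = t - r"
  have r: "0 < r" "r < 1" "r * r = \<rho>" using assms by (auto simp: r_def)
  have t: "0 < t" "t < 1" "0 < \<delta>" using r by (auto simp: t_def \<delta>_def field_simps)
  define A where "A = {z :: ('a, 'b) pt. ptnorm z < \<delta>}"
  define a where "a = measure lborel A"
  have opA: "open A" unfolding A_def by (intro open_Collect_less continuous_intros)
  then have [measurable]: "A \<in> sets borel" by simp
  have "A \<subseteq> ball 0 \<delta> \<times> ball 0 \<delta>" by (auto simp: A_def ptnorm_def)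
  then have bA: "bounded A"
    by (rule bounded_subset[rotated]) (intro bounded_Times bounded_ball)
  have Afin: "emeasure lborel A < \<infinity>" using emeasure_bounded_finite[OF bA] .
  have "0 \<in> A" using t by (simp add: A_def ptnorm_def)
  then have "emeasure lborel A \<noteq> 0"
    using open_not_negligible[OF opA] by (auto simp: negligible_iff_emeasure0 opA)
  moreover have "emeasure lborel A = ennreal a"
    using Afin by (simp add: a_def emeasure_eq_ennreal_measure)
  moreover have "0 \<le> a" by (simp add: a_def)
  ultimately have a: "0 < a" "emeasure lborel A = ennreal a"
    by (cases "a = 0"; simp)+
  define V where "V = enn2real (ballvol TYPE('a) * ballvol TYPE('b))"
  have V: "ballvol TYPE('a) * ballvol TYPE('b) = ennreal V" "0 \<le> V"
    using ballvol(2)[where 'a='a] ballvol(2)[where 'a='b] by (auto simp: V_def less_top ennreal_mult_less_top)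
  define K where "K = 1 / (1 - t)\<^sup>2"
  have K: "0 \<le> K" by (simp add: K_def)
  \<comment> \<open>Two Cauchy factors \<open>K\<close>, the product \<open>V\<close> of the ball
    volumes, and division by the volume \<open>a\<close> of the neighbourhood.\<close>
  define C where "C = sqrt (K * (K * V) / a)"
  show ?thesis
  proof (rule that[of C])
    show "0 \<le> C" using K V a by (simp add: C_def)
    fix f :: "('a, 'b) pt \<Rightarrow> complex" and w :: "('a, 'b) pt"
    assume H: "in_H2 f" and w: "ptnorm w \<le> \<rho>"
    then have f: "holo_fun Omega f" and fin: "hardy_sq f < \<infinity>" by (auto simp: in_H2_def)
    have hs: "hardy_sq f = ennreal ((hardy_norm f)\<^sup>2)"
      using fin by (simp add: hardy_norm_def)
    define G where "G = (\<lambda>z. ennreal ((cmod (f (r *\<^sub>R z)))\<^sup>2) * indicator Omega (r *\<^sub>R z))"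
    have G[measurable]: "G \<in> borel_measurable borel"
    proof -
      have "(\<lambda>z. r *\<^sub>R z :: ('a, 'b) pt) \<in> borel_measurable borel" by measurable
      from measurable_compose[OF this borel_measurable_square_on_Omega[OF f]]
      show ?thesis by (simp add: G_def)
    qed
    define w' where "w' = (1 / r) *\<^sub>R w"
    have w': "ptnorm w' \<le> r" "r *\<^sub>R w' = w"
      using r w by (auto simp: w'_def ptnorm_scaleR field_simps)
    have "ennreal ((cmod (f w))\<^sup>2) * ennreal a = (\<integral>\<^sup>+x. ennreal ((cmod (f w))\<^sup>2) * indicator A x \<partial>lborel)"
      by (simp add: nn_integral_cmult a)
    also have "\<dots> \<le> 1 * (\<integral>\<^sup>+x. G (w' + x) * indicator A x \<partial>lborel)"
    proof (rule nn_integral_le_rotation_mean[where U="\<lambda>s. rot (cis (2 * pi * s)) (cis (2 * pi * s))"])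
      fix x assume x: "x \<in> A"
      have line: "w + cscale c (r *\<^sub>R x) \<in> Omega" if "cmod c \<le> 1" for c
      proof -
        have "ptnorm (w' + cscale c x) \<le> ptnorm w' + cmod c * ptnorm x"
          using ptnorm_triangle[of w' "cscale c x"] by (simp add: ptnorm_cscale)
        also have "\<dots> \<le> r + 1 * \<delta>"
          using w' x that by (intro add_mono mult_mono) (auto simp: A_def)
        finally have "ptnorm (w' + cscale c x) \<le> 1"
          using t by (simp add: \<delta>_def)
        then have "r * ptnorm (w' + cscale c x) < 1"
          using r by (smt (verit) mult_left_le)
        then have "r *\<^sub>R (w' + cscale c x) \<in> Omega"
          using r by (simp add: Omega_iff ptnorm_scaleR)
        then show ?thesis by (simp add: scaleR_add_right w')
      qed
      have eq: "G (w' + rot c c x) = ennreal ((cmod (f (w + cscale c (r *\<^sub>R x))))\<^sup>2)" if "cmod c \<le> 1" for c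
        using line[OF that] by (simp add: G_def scaleR_add_right w' rot_def cscale_def[symmetric])
      \<comment> \<open>The slice is evaluated at its centre; \<open>t = 0\<close> makes the Cauchy
        factor equal to 1.\<close>
      show "ennreal ((cmod (f w))\<^sup>2) \<le> 1 * (\<integral>\<^sup>+s. G (w' + rot (cis (2 * pi * s)) (cis (2 * pi * s)) x) * indicator {0..1} s \<partial>lborel)"
        using square_le_slice_mean[OF f line, of 0 0] by (simp add: eq)
    next
      show "(\<lambda>x. G (w' + x)) \<in> borel_measurable borel" by measurable
      show "A \<in> sets borel" by measurable
    qed (rule linear_rot, simp add: norm_rot, (rule borel_measurable_rot; rule continuous_on_circle),
        simp add: A_def ptnorm_def rot_def norm_vector_smult)
    also have "\<dots> \<le> (\<integral>\<^sup>+x. G (w' + x) * indicator {z. ptnorm z < t} (w' + x) \<partial>lborel)"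
    proof -
      have "ptnorm (w' + x) < t" if "x \<in> A" for x
        using that w' ptnorm_triangle[of w' x] by (simp add: A_def \<delta>_def)
      then show ?thesis by (auto intro!: nn_integral_mono simp: indicator_def)
    qed
    also have "\<dots> = (\<integral>\<^sup>+x. G x * indicator {z. ptnorm z < t} x \<partial>lborel)"
    proof (rule nn_integral_lborel_translate[where g="\<lambda>x. G x * indicator {z. ptnorm z < t} x"])
      have [measurable]: "{z :: ('a, 'b) pt. ptnorm z < t} \<in> sets borel"
        by (intro borel_open open_Collect_less continuous_intros)
      show "(\<lambda>x. G x * indicator {z. ptnorm z < t} x) \<in> borel_measurable borel" by measurable
    qed
    also have "\<dots> \<le> ennreal K * (ennreal K * (ennreal V * ennreal ((hardy_norm f)\<^sup>2)))"
      using nn_integral_square_interior_le[OF f r(1,2) t(1,2)]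
      by (simp only: G_def K_def V(1) hs)
    finally have "(cmod (f w))\<^sup>2 * a \<le> K * (K * (V * (hardy_norm f)\<^sup>2))"
      using K V(2) a(1) by (simp add: ennreal_mult[symmetric])
    then have "(cmod (f w))\<^sup>2 \<le> (C * hardy_norm f)\<^sup>2"
      using K V(2) a(1) by (simp add: C_def power_mult_distrib field_simps)
    moreover have "0 \<le> C * hardy_norm f"
      using K V a by (simp add: C_def hardy_norm_def)
    ultimately show "cmod (f w) \<le> C * hardy_norm f"
      by (rule power2_le_imp_le)
  qed
qed


subsection \<open>Homogeneous expansion\<close>

text \<open>The degree \<open>k\<close> part of the Taylor expansion of \<open>f\<close> at 0, read
  off from the slice through \<open>w\<close> instead of from multi-index derivatives. It is
  meaningful for every \<open>w\<close>, also outside \<open>Omega\<close>, since each slice domain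
  is a neighbourhood of 0.\<close>

definition hom_part :: "nat \<Rightarrow> (('a::finite, 'b::finite) pt \<Rightarrow> complex) \<Rightarrow> ('a, 'b) pt \<Rightarrow> complex" where
  "hom_part k f w = (deriv ^^ k) (\<lambda>c. f (cscale c w)) 0 / fact k"

lemma open_slice: "open {c. cscale c w \<in> Omega}"
  unfolding Omega_iff ptnorm_cscale by (intro open_Collect_less continuous_intros)

lemma slice_holomorphic:
  assumes "holo_fun Omega f"
  shows "(\<lambda>c. f (cscale c w)) holomorphic_on {c. cscale c w \<in> Omega}"
  using holo_fun_line[OF assms, of 0 w] by simp

lemma zero_in_slice: "0 \<in> {c. cscale c w \<in> Omega}"
  by (simp add: Omega_iff ptnorm_def)

text \<open>Derivatives at 0 see only the germ of the slice. This makes operators built from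
  \<open>hom_part\<close> well defined on elements of the Hardy space.\<close>

lemma hom_part_cong:
  assumes "\<And>z. z \<in> Omega \<Longrightarrow> f z = g z"
  shows "hom_part k f w = hom_part k g w"
proof -
  have "eventually (\<lambda>c. f (cscale c w) = g (cscale c w)) (nhds 0)"
    using eventually_nhds_in_open[OF open_slice zero_in_slice[of w]]
    by eventually_elim (simp add: assms)
  then show ?thesis
    unfolding hom_part_def by (simp add: higher_deriv_cong_ev)
qed

lemma hom_part_linear:
  assumes f: "holo_fun Omega f" and g: "holo_fun Omega g"
  shows "hom_part k (\<lambda>z. a * f z + b * g z) w = a * hom_part k f w + b * hom_part k g w"
proof -
  note h = slice_holomorphic[OF f, of w] slice_holomorphic[OF g, of w]
  have "(deriv ^^ k) (\<lambda>c. a * f (cscale c w) + b * g (cscale c w)) 0 =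
      a * (deriv ^^ k) (\<lambda>c. f (cscale c w)) 0 + b * (deriv ^^ k) (\<lambda>c. g (cscale c w)) 0"
    by (subst higher_deriv_add[OF _ _ open_slice zero_in_slice])
      (auto intro!: holomorphic_on_mult holomorphic_on_const h
        simp: higher_deriv_cmult[OF h(1) zero_in_slice open_slice]
          higher_deriv_cmult[OF h(2) zero_in_slice open_slice])
  then show ?thesis
    by (simp add: hom_part_def add_divide_distrib)
qed

lemma hom_part_cscale:
  assumes f: "holo_fun Omega f"
  shows "hom_part k f (cscale u w) = u ^ k * hom_part k f w"
proof -
  have "(deriv ^^ k) (\<lambda>c. f (cscale (u * c) w)) 0 = u ^ k * (deriv ^^ k) (\<lambda>c. f (cscale c w)) (u * 0)"
    by (rule higher_deriv_compose_linear[OF slice_holomorphic[OF f] open_slice[of "cscale u w"] open_slice zero_in_slice])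
      (simp add: mult.commute)
  then show ?thesis
    by (simp add: hom_part_def mult.commute)
qed

section \<open>Size, convergence and polynomial nature of the homogeneous parts\<close>

context
  fixes f :: "('a::finite, 'b::finite) pt \<Rightarrow> complex" and M \<rho> :: real
  assumes f: "holo_fun Omega f" and \<rho>: "0 < \<rho>" "\<rho> < 1"
    and bound: "\<And>w. ptnorm w \<le> \<rho> \<Longrightarrow> cmod (f w) \<le> M"
begin

lemma bound_nonneg: "0 \<le> M"
  using bound[of 0] \<rho> order_trans[OF norm_ge_zero] by (auto simp: ptnorm_def)

lemma cball_slice:
  assumes "ptnorm w \<le> T" "0 < T" "cmod c \<le> \<rho> / T"
  shows "ptnorm (cscale c w) \<le> \<rho>"
proof -
  have "ptnorm (cscale c w) \<le> \<rho> / T * T"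
    unfolding ptnorm_cscale using assms \<rho> by (intro mult_mono) auto
  then show ?thesis using assms by simp
qed

lemma cball_subset_slice:
  assumes "ptnorm w \<le> T" "0 < T"
  shows "cball 0 (\<rho> / T) \<subseteq> {c. cscale c w \<in> Omega}"
proof
  fix c :: complex assume "c \<in> cball 0 (\<rho> / T)"
  then have "ptnorm (cscale c w) \<le> \<rho>" using assms by (intro cball_slice[of w T]) auto
  then show "c \<in> {c. cscale c w \<in> Omega}" using \<rho> by (simp add: Omega_iff)
qed

text \<open>Cauchy's inequality on the slice disc of radius \<open>\<rho> / T\<close>. For
  \<open>T < \<rho>\<close> it gives geometric decay in \<open>k\<close>; for large \<open>T\<close>
  it gives the polynomial growth that Liouville's theorem requires.\<close>

lemma norm_hom_part_le:
  assumes w: "ptnorm w \<le> T" "0 < T"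
  shows "cmod (hom_part k f w) \<le> M * (T / \<rho>) ^ k"
proof -
  note hol = holomorphic_on_subset[OF slice_holomorphic[OF f] cball_subset_slice[OF w]]
  have "cmod ((deriv ^^ k) (\<lambda>c. f (cscale c w)) 0) \<le> fact k * M / (\<rho> / T) ^ k"
  proof (rule Cauchy_inequality)
    show "(\<lambda>c. f (cscale c w)) holomorphic_on ball 0 (\<rho> / T)"
      by (rule holomorphic_on_subset[OF hol]) auto
    show "continuous_on (cball 0 (\<rho> / T)) (\<lambda>c. f (cscale c w))"
      by (rule holomorphic_on_imp_continuous_on[OF hol])
    show "0 < \<rho> / T" using \<rho> w by simp
    show "cmod (f (cscale c w)) \<le> M" if "cmod (0 - c) = \<rho> / T" for c
      using that by (intro bound cball_slice[OF w]) simp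
  qed
  then show ?thesis
    using \<rho> w by (simp add: hom_part_def norm_divide field_simps)
qed

text \<open>Since \<open>T < \<rho>\<close>, the disc of radius \<open>\<rho> / T\<close> contains
  the parameter 1, at which the slice takes the value \<open>f w\<close>.\<close>

lemma hom_part_sums:
  assumes w: "ptnorm w \<le> T" "0 < T" "T < \<rho>"
  shows "(\<lambda>k. hom_part k f w) sums f w"
proof -
  have "(\<lambda>c. f (cscale c w)) holomorphic_on ball 0 (\<rho> / T)"
    by (rule holomorphic_on_subset[OF slice_holomorphic[OF f] order_trans[OF ball_subset_cball cball_subset_slice[OF w(1,2)]]])
  from holomorphic_power_series[OF this, of 1] show ?thesis
    using w by (simp add: hom_part_def)
qed

lemma taylor_tail_le:
  assumes w: "ptnorm w \<le> T" "0 < T" "T < \<rho>"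
  shows "cmod (f w - (\<Sum>k<m. hom_part k f w)) \<le> M * (T / \<rho>) ^ m / (1 - T / \<rho>)"
proof -
  have th: "0 < T / \<rho>" "T / \<rho> < 1" using w \<rho> by auto
  have "(\<lambda>k. hom_part (k + m) f w) sums (f w - (\<Sum>k<m. hom_part k f w))"
    by (rule sums_split_initial_segment[OF hom_part_sums[OF w]])
  moreover have "(\<lambda>k. M * (T / \<rho>) ^ m * (T / \<rho>) ^ k) sums (M * (T / \<rho>) ^ m * (1 / (1 - T / \<rho>)))"
    using th by (intro sums_mult geometric_sums) auto
  moreover have "cmod (hom_part (k + m) f w) \<le> M * (T / \<rho>) ^ m * (T / \<rho>) ^ k" for k
    using norm_hom_part_le[OF w(1,2), of "k + m"] by (simp add: power_add mult_ac)
  ultimately show ?thesis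
    using norm_suminf_le[of "\<lambda>k. hom_part (k + m) f w" "\<lambda>k. M * (T / \<rho>) ^ m * (T / \<rho>) ^ k"]
    by (simp add: sums_iff)
qed

text \<open>On bounded sets \<open>hom_part k f\<close> is the uniform limit, as \<open>\<lambda> \<rightarrow> 0\<close>, of
  \<open>(f(\<lambda>w) - \<Sum>\<^sub>i\<^sub><\<^sub>k \<lambda>\<^sup>i hom_part i f w) / \<lambda>\<^sup>k\<close>.\<close>

lemma hom_part_line_holomorphic: "(\<lambda>c. hom_part k f (p + cscale c q)) holomorphic_on UNIV"
\<comment> \<open>The approximants involve all lower homogeneous parts, hence the strong
  induction.\<close>
proof (induction k rule: less_induct)
  case (less k)
  have "(\<lambda>c. hom_part k f (p + cscale c q)) holomorphic_on ball 0 B" if "0 < B" for B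
  proof -
    define T where "T = ptnorm p + B * ptnorm q + 1"
    have "0 \<le> ptnorm p" "0 \<le> B * ptnorm q" using that by auto
    then have T: "0 < T" unfolding T_def by linarith
    \<comment> \<open>\<open>T\<close> bounds \<open>ptnorm\<close> on the line over the disc, so
      scaling by \<open>l n\<close> brings the points to size at most
      \<open>\<rho> / (n + 2)\<close>. The tail estimate then has ratio \<open>1 / (n + 2)\<close>;
      the summand 2 keeps it at most 1/2 for every \<open>n\<close>.\<close>
    define l where "l = (\<lambda>n::nat. \<rho> / (T * (real n + 2)))"
    have l: "0 < l n" for n using T \<rho> by (simp add: l_def)
    define g where "g = (\<lambda>n c. (f (cscale (l n) (p + cscale c q))
        - (\<Sum>i<k. l n ^ i * hom_part i f (p + cscale c q))) / l n ^ k)"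
    have small: "ptnorm (cscale (l n) (p + cscale c q)) \<le> \<rho> / (real n + 2)" if c: "c \<in> ball 0 B" for n c
    proof -
      have "ptnorm (p + cscale c q) \<le> ptnorm p + cmod c * ptnorm q"
        using ptnorm_triangle[of p "cscale c q"] by (simp add: ptnorm_cscale)
      also have "\<dots> \<le> ptnorm p + B * ptnorm q"
        using c by (intro add_left_mono mult_right_mono) auto
      also have "\<dots> \<le> T" by (simp add: T_def)
      finally have "ptnorm (cscale (l n) (p + cscale c q)) \<le> l n * T"
        using l[of n] by (simp add: ptnorm_cscale del: cscale_simps)
      also have "\<dots> = \<rho> / (real n + 2)" using T by (simp add: l_def)
      finally show ?thesis .
    qed
    have small1: "\<rho> / (real n + 2) < \<rho>" "0 < \<rho> / (real n + 2)" for n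
      using \<rho> by (auto simp: field_simps intro: add_pos_nonneg)
    show ?thesis
    proof (rule holomorphic_uniform_sequence)
      show "g n holomorphic_on ball 0 B" for n
      proof -
        have "(\<lambda>c. f (cscale (l n) p + cscale c (cscale (l n) q))) holomorphic_on ball 0 B"
        proof (rule holomorphic_on_subset[OF holo_fun_line[OF f]], rule subsetI)
          fix c assume "c \<in> ball (0::complex) B"
          from small[OF this, of n] small1[of n] \<rho>
          show "c \<in> {c. cscale (l n) p + cscale c (cscale (l n) q) \<in> Omega}"
            by (simp add: Omega_iff mult.commute)
        qed
        then have "(\<lambda>c. f (cscale (l n) (p + cscale c q))) holomorphic_on ball 0 B"
          by (simp add: mult.commute)
        then show ?thesis
          unfolding g_def using l[of n]
          by (intro holomorphic_intros holomorphic_on_subset[OF less.IH]) auto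
      qed
      fix x :: complex assume "x \<in> ball 0 B"
      then obtain d where d: "0 < d" "cball x d \<subseteq> ball 0 B"
        using open_contains_cball open_ball by metis
      have "uniform_limit (ball 0 B) g (\<lambda>c. hom_part k f (p + cscale c q)) sequentially"
      proof (rule uniform_limitI)
        fix e :: real assume e: "0 < e"
        \<comment> \<open>The tail from degree \<open>k + 1\<close> on is at most
          \<open>2 * M * (1 / (n + 2)) ^ Suc k\<close>; dividing by \<open>l n ^ k\<close> leaves
          \<open>D / (n + 2)\<close>.\<close>
        define D where "D = 2 * M * (T / \<rho>) ^ k"
        have "(\<lambda>n. D / (real n + 2)) \<longlonglongrightarrow> 0"
          by real_asymp
        then have "eventually (\<lambda>n. D / (real n + 2) < e) sequentially"
          using e by (rule order_tendstoD)
        then show "\<forall>\<^sub>F n in sequentially. \<forall>c\<in>ball 0 B. dist (g n c) (hom_part k f (p + cscale c q)) < e"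
        proof eventually_elim
          case (elim n)
          show ?case
          proof
            fix c assume c: "c \<in> ball (0::complex) B"
            define w where "w = p + cscale c q"
            have "cmod (f (cscale (l n) w) - (\<Sum>i<Suc k. hom_part i f (cscale (l n) w)))
                \<le> M * (\<rho> / (real n + 2) / \<rho>) ^ Suc k / (1 - \<rho> / (real n + 2) / \<rho>)"
              using small[OF c, of n] small1[of n] by (intro taylor_tail_le) (auto simp: w_def)
            also have "\<dots> = M * (1 / (real n + 2)) ^ Suc k * (1 / (1 - 1 / (real n + 2)))"
            proof -
              have "\<rho> / (real n + 2) / \<rho> = 1 / (real n + 2)" using \<rho> by simp
              then show ?thesis by simp
            qed
            also have "\<dots> \<le> M * (1 / (real n + 2)) ^ Suc k * 2"
              using bound_nonneg by (intro mult_left_mono) (auto simp: field_simps)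
            finally have *: "cmod (f (cscale (l n) w) - (\<Sum>i<Suc k. l n ^ i * hom_part i f w))
                \<le> M * (1 / (real n + 2)) ^ Suc k * 2"
              by (simp only: hom_part_cscale[OF f] of_real_power)
            \<comment> \<open>Homogeneity turns the degree \<open>k\<close> term at the scaled point
              into \<open>l n ^ k * hom_part k f w\<close>, so subtracting the limit extends the sum
              by one term.\<close>
            have "g n c - hom_part k f w = (f (cscale (l n) w) - (\<Sum>i<Suc k. l n ^ i * hom_part i f w)) / l n ^ k"
              using l[of n] by (simp add: g_def w_def field_simps)
            then have "cmod (g n c - hom_part k f w) \<le> M * (1 / (real n + 2)) ^ Suc k * 2 / l n ^ k"
              using divide_right_mono[OF *, of "l n ^ k"] zero_less_power[OF l[of n], of k]
              by (simp only: norm_divide norm_of_real abs_of_pos less_imp_le True_implies_equals)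
            also have "\<dots> = D / (real n + 2)"
              using T \<rho> by (simp add: D_def l_def power_divide power_mult_distrib mult_ac)
            also note elim
            finally show "dist (g n c) (hom_part k f (p + cscale c q)) < e"
              by (simp add: dist_norm w_def)
          qed
        qed
      qed
      then show "\<exists>d>0. cball x d \<subseteq> ball 0 B \<and> uniform_limit (cball x d) g (\<lambda>c. hom_part k f (p + cscale c q)) sequentially"
        using d uniform_limit_on_subset by blast
    qed auto
  qed
  then have "(\<lambda>c. hom_part k f (p + cscale c q)) holomorphic_on (\<Union>B\<in>{0<..}. ball 0 B)"
    by (intro holomorphic_on_UN_open) auto
  moreover have "(\<Union>B\<in>{0<..}. ball (0::complex) B) = UNIV"
  proof -
    have "x \<in> ball 0 (cmod x + 1)" "cmod x + 1 \<in> {0<..}" for x :: complex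
      by (auto simp: add_nonneg_pos)
    then show ?thesis by blast
  qed
  ultimately show ?case by simp
qed

text \<open>The restriction to a line is entire and grows at most like \<open>cmod c ^ k\<close>,
  because \<open>ptnorm (p + cscale c q) \<le> cmod c * E\<close> once
  \<open>1 \<le> cmod c\<close>.\<close>

lemma hom_part_line_polynomial:
  "\<exists>a. \<forall>c. hom_part k f (p + cscale c q) = (\<Sum>i\<le>k. a i * c ^ i)"
proof -
  define E where "E = ptnorm p + ptnorm q + 1"
  have E: "0 < E" by (simp add: E_def add_nonneg_pos)
  have "cmod (hom_part k f (p + cscale c q)) \<le> M * (E / \<rho>) ^ k * cmod c ^ k" if c: "1 \<le> cmod c" for c
  proof -
    have "ptnorm (p + cscale c q) \<le> 1 * ptnorm p + cmod c * ptnorm q"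
      using ptnorm_triangle[of p "cscale c q"] by (simp add: ptnorm_cscale)
    also have "\<dots> \<le> cmod c * ptnorm p + cmod c * ptnorm q"
      using c by (intro add_right_mono mult_right_mono) auto
    also have "\<dots> \<le> cmod c * E"
      by (simp add: E_def algebra_simps)
    finally have "cmod (hom_part k f (p + cscale c q)) \<le> M * (cmod c * E / \<rho>) ^ k"
      using c E by (intro norm_hom_part_le mult_pos_pos) auto
    then show ?thesis by (simp add: power_mult_distrib power_divide mult_ac)
  qed
  from Liouville_polynomial[OF hom_part_line_holomorphic this]
  show ?thesis by (intro exI allI) assumption
qed

lemma taylor_line_polynomial:
  "\<exists>a. \<forall>c. (\<Sum>k<m. hom_part k f (p + cscale c q)) = (\<Sum>i<m. a i * c ^ i)"
proof -
  obtain a where a: "\<And>k c. hom_part k f (p + cscale c q) = (\<Sum>i\<le>k. a k i * c ^ i)"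
    using hom_part_line_polynomial[of _ p q] by metis
  \<comment> \<open>Coefficients beyond degree \<open>k\<close> are padded by 0, so all summands
    share the powers below \<open>m\<close>.\<close>
  have "(\<Sum>k<m. hom_part k f (p + cscale c q)) = (\<Sum>i<m. (\<Sum>k<m. if i \<le> k then a k i else 0) * c ^ i)" for c
  proof -
    have "(\<Sum>k<m. hom_part k f (p + cscale c q)) = (\<Sum>k<m. \<Sum>i<m. (if i \<le> k then a k i else 0) * c ^ i)"
      unfolding a by (intro sum.cong sum.mono_neutral_cong_left) auto
    also have "\<dots> = (\<Sum>i<m. (\<Sum>k<m. if i \<le> k then a k i else 0) * c ^ i)"
      unfolding sum_distrib_right by (rule sum.swap)
    finally show ?thesis .
  qed
  then show ?thesis by (intro exI allI)
qed

end


subsection \<open>Interpolation\<close>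

text \<open>The basis polynomial attached to node \<open>j\<close> among the nodes 0, ...,
  \<open>m - 1\<close>.\<close>

definition lagrange :: "nat \<Rightarrow> nat \<Rightarrow> complex \<Rightarrow> complex" where
  "lagrange m j x = (\<Prod>i\<in>{..<m} - {j}. (x - of_nat i) / (of_nat j - of_nat i))"

text \<open>Both sides are polynomials of degree below \<open>m\<close> that agree at the
  \<open>m\<close> nodes. For \<open>m = 0\<close> both sums are empty.\<close>

lemma lagrange_interpolation:
  "(\<Sum>i<m. a i * x ^ i) = (\<Sum>j<m. lagrange m j x * (\<Sum>i<m. a i * of_nat j ^ i))"
proof (cases "m = 0")
  case False
  define p where "p = (\<Sum>i<m. monom (a i) i)"
  define l where "l = (\<lambda>j. \<Prod>i\<in>{..<m} - {j}. smult (1 / (of_nat j - of_nat i)) [:- of_nat i :: complex, 1:])"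
  define q where "q = (\<Sum>j<m. smult (poly p (of_nat j)) (l j))"
  have l: "poly (l j) x = lagrange m j x" for j x
    by (simp add: l_def lagrange_def poly_prod diff_divide_distrib)
  have "degree (l j) < m" if "j < m" for j
  proof -
    have "degree (l j) \<le> (\<Sum>i\<in>{..<m} - {j}. degree (smult (1 / (of_nat j - of_nat i)) [:- of_nat i :: complex, 1:]))"
      unfolding l_def by (rule degree_prod_sum_le[unfolded comp_def]) simp
    also have "\<dots> \<le> (\<Sum>i\<in>{..<m} - {j}. 1)"
      by (intro sum_mono) simp
    also have "\<dots> < m" using that by simp
    finally show ?thesis .
  qed
  then have "degree q < m"
    unfolding q_def using False
    by (intro degree_sum_less) (auto intro: le_less_trans[OF degree_smult_le])
  moreover have "degree p < m"
    unfolding p_def using False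
    by (intro degree_sum_less) (auto intro: le_less_trans[OF degree_monom_le])
  moreover have "poly p x = poly q x" if x: "x \<in> of_nat ` {..<m}" for x
  proof -
    obtain k where k: "k < m" "x = of_nat k" using x by auto
    have "lagrange m j (of_nat k) = (if j = k then 1 else 0)" if "j < m" for j
      using k by (auto simp: lagrange_def)
    then show ?thesis
      using k by (simp add: q_def poly_sum l if_distrib[of "\<lambda>u. _ * u"] cong: if_cong)
  qed
  moreover have "card (of_nat ` {..<m} :: complex set) = m"
    by (simp add: card_image inj_on_def)
  ultimately have "p = q"
    by (intro poly_eqI_degree[of "of_nat ` {..<m}"]) auto
  then have "poly p x = poly q x" by simp
  then show ?thesis
    by (simp add: q_def poly_sum l p_def poly_monom mult.commute)
qed simp

text \<open>One-variable interpolation is applied to one coordinate after another; the induction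
  moves the coordinates in \<open>S\<close> onto the integer grid.\<close>

lemma multivariate_lagrange_interpolation:
  fixes F :: "('i \<Rightarrow> complex) \<Rightarrow> complex"
  assumes sep: "\<And>h i. \<exists>a. \<forall>c. F (h(i := c)) = (\<Sum>j<m. a j * c ^ j)" and "finite S"
  shows "F h = (\<Sum>\<nu>\<in>S \<rightarrow>\<^sub>E {..<m}. (\<Prod>i\<in>S. lagrange m (\<nu> i) (h i)) *
    F (\<lambda>i. if i \<in> S then of_nat (\<nu> i) else h i))"
  using \<open>finite S\<close>
proof induction
  case empty
  then show ?case by simp
next
  case (insert x S)
  define H where "H = (\<lambda>S \<nu> i. if i \<in> S then of_nat (\<nu> i) else h i)"
  have one: "F (H S \<nu>) = (\<Sum>j<m. lagrange m j (h x) * F (H (insert x S) (\<nu>(x := j))))" for \<nu>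
  proof -
    obtain a where a: "\<And>c. F ((H S \<nu>)(x := c)) = (\<Sum>j<m. a j * c ^ j)"
      using sep by metis
    have "F (H S \<nu>) = F ((H S \<nu>)(x := h x))"
      using insert by (intro arg_cong[of _ _ F]) (auto simp: H_def)
    also have "\<dots> = (\<Sum>j<m. lagrange m j (h x) * F ((H S \<nu>)(x := of_nat j)))"
      unfolding a by (rule lagrange_interpolation)
    also have "\<dots> = (\<Sum>j<m. lagrange m j (h x) * F (H (insert x S) (\<nu>(x := j))))"
      using insert by (intro sum.cong refl arg_cong2[where f="(*)"] arg_cong[of _ _ F]) (auto simp: H_def)
    finally show ?thesis .
  qed
  have pr: "(\<Prod>i\<in>insert x S. lagrange m ((\<nu>(x := j)) i) (h i)) =
      lagrange m j (h x) * (\<Prod>i\<in>S. lagrange m (\<nu> i) (h i))" for \<nu> j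
    using insert by (auto intro!: prod.cong)
  have "(\<Sum>\<nu>\<in>insert x S \<rightarrow>\<^sub>E {..<m}. (\<Prod>i\<in>insert x S. lagrange m (\<nu> i) (h i)) * F (H (insert x S) \<nu>))
      = (\<Sum>(j, \<nu>)\<in>{..<m} \<times> (S \<rightarrow>\<^sub>E {..<m}).
          lagrange m j (h x) * (\<Prod>i\<in>S. lagrange m (\<nu> i) (h i)) * F (H (insert x S) (\<nu>(x := j))))"
    unfolding PiE_insert_eq
    by (subst sum.reindex[OF inj_combinator[OF insert.hyps(2)]])
      (simp only: comp_def case_prod_beta' pr)
  also have "\<dots> = (\<Sum>\<nu>\<in>S \<rightarrow>\<^sub>E {..<m}. \<Sum>j<m.
          lagrange m j (h x) * (\<Prod>i\<in>S. lagrange m (\<nu> i) (h i)) * F (H (insert x S) (\<nu>(x := j))))"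
    unfolding sum.cartesian_product[symmetric] by (rule sum.swap)
  also have "\<dots> = (\<Sum>\<nu>\<in>S \<rightarrow>\<^sub>E {..<m}. (\<Prod>i\<in>S. lagrange m (\<nu> i) (h i)) * F (H S \<nu>))"
    unfolding one sum_distrib_left by (simp add: mult_ac)
  also have "\<dots> = F h"
    using insert by (simp add: H_def)
  finally show ?case by (simp add: H_def)
qed

section \<open>Passage between points and families of coordinates\<close>

definition coord :: "('a::finite, 'b::finite) pt \<Rightarrow> 'a + 'b \<Rightarrow> complex" where
  "coord z i = (case i of Inl k \<Rightarrow> fst z $ k | Inr k \<Rightarrow> snd z $ k)"

definition of_coord :: "('a + 'b \<Rightarrow> complex) \<Rightarrow> ('a::finite, 'b::finite) pt" where
  "of_coord h = (\<chi> k. h (Inl k), \<chi> k. h (Inr k))"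

lemma of_coord_coord: "of_coord (coord z) = z"
  by (simp add: of_coord_def coord_def prod_eq_iff vec_eq_iff)

text \<open>Varying one coordinate moves the point along a complex line, so polynomiality on lines
  gives polynomiality in each coordinate.\<close>

lemma of_coord_upd:
  "of_coord (h(i := c)) = of_coord (h(i := 0)) + cscale c (of_coord ((\<lambda>_. 0)(i := 1)))"
  by (auto simp: of_coord_def cscale_def prod_eq_iff vec_eq_iff)

lemma norm_coord_le: "cmod (coord z i) \<le> ptnorm z"
  using Finite_Cartesian_Product.norm_nth_le[of "fst z"] Finite_Cartesian_Product.norm_nth_le[of "snd z"]
  by (auto simp: coord_def ptnorm_def le_max_iff_disj split: sum.split)

subsection \<open>Finite rank approximation\<close>

text \<open>Bounded holomorphic functions form an algebra inside the Hardy space, so products of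
  Lagrange factors stay in it.\<close>

definition hinfty :: "(('a::finite, 'b::finite) pt \<Rightarrow> complex) \<Rightarrow> bool" where
  "hinfty h \<longleftrightarrow> holo_fun Omega h \<and> (\<exists>e. \<forall>z\<in>Omega. cmod (h z) \<le> e)"

lemma hinfty_in_H2: "hinfty h \<Longrightarrow> in_H2 h"
  unfolding hinfty_def in_H2_def using hardy_sq_le le_less_trans by (metis ennreal_less_top infinity_ennreal_def)

lemma hinfty_const: "hinfty (\<lambda>_. c)"
  unfolding hinfty_def holo_fun_def
  by (auto intro!: exI[of _ "\<lambda>_. 0"] derivative_eq_intros)

lemma hinfty_add:
  assumes "hinfty g" "hinfty h"
  shows "hinfty (\<lambda>z. g z + h z)"
  unfolding hinfty_def holo_fun_def
proof (intro conjI ballI)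
  fix z :: "('a, 'b) pt" assume z: "z \<in> Omega"
  obtain D E where "(g has_derivative D) (at z)" "\<And>x. D (cscale \<i> x) = \<i> * D x"
     "(h has_derivative E) (at z)" "\<And>x. E (cscale \<i> x) = \<i> * E x"
    using assms z unfolding hinfty_def holo_fun_def by metis
  then show "\<exists>D. ((\<lambda>z. g z + h z) has_derivative D) (at z) \<and> (\<forall>x. D (cscale \<i> x) = \<i> * D x)"
    by (intro exI[of _ "\<lambda>x. D x + E x"]) (auto intro: has_derivative_add simp: algebra_simps)
next
  obtain d e where "\<forall>z\<in>Omega. cmod (g z) \<le> d" "\<forall>z\<in>Omega. cmod (h z) \<le> e"
    using assms unfolding hinfty_def by auto
  then show "\<exists>e. \<forall>z\<in>Omega. cmod (g z + h z) \<le> e"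
    by (intro exI[of _ "d + e"]) (auto intro: norm_triangle_le add_mono)
qed

lemma hinfty_mult:
  assumes "hinfty g" "hinfty h"
  shows "hinfty (\<lambda>z. g z * h z)"
  unfolding hinfty_def holo_fun_def
proof (intro conjI ballI)
  fix z :: "('a, 'b) pt" assume z: "z \<in> Omega"
  obtain D E where "(g has_derivative D) (at z)" "\<And>x. D (cscale \<i> x) = \<i> * D x"
     "(h has_derivative E) (at z)" "\<And>x. E (cscale \<i> x) = \<i> * E x"
    using assms z unfolding hinfty_def holo_fun_def by metis
  then show "\<exists>D. ((\<lambda>z. g z * h z) has_derivative D) (at z) \<and> (\<forall>x. D (cscale \<i> x) = \<i> * D x)"
    by (intro exI[of _ "\<lambda>x. g z * E x + D x * h z"] conjI has_derivative_mult)
      (simp_all add: algebra_simps)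
next
  obtain d e where "\<forall>z\<in>Omega. cmod (g z) \<le> d" "\<forall>z\<in>Omega. cmod (h z) \<le> e"
    using assms unfolding hinfty_def by auto
  then have "cmod (g z * h z) \<le> d * e" if "z \<in> Omega" for z
    using that unfolding norm_mult by (intro mult_mono) (auto intro: order_trans[OF norm_ge_zero])
  then show "\<exists>e. \<forall>z\<in>Omega. cmod (g z * h z) \<le> e" by blast
qed

lemma hinfty_sum: "(\<And>i. i \<in> I \<Longrightarrow> hinfty (g i)) \<Longrightarrow> hinfty (\<lambda>z. \<Sum>i\<in>I. g i z)"
  by (induction I rule: infinite_finite_induct) (auto intro: hinfty_const hinfty_add)

lemma hinfty_prod: "(\<And>i. i \<in> I \<Longrightarrow> hinfty (g i)) \<Longrightarrow> hinfty (\<lambda>z. \<Prod>i\<in>I. g i z)"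
  by (induction I rule: infinite_finite_induct) (auto intro: hinfty_const hinfty_mult)

lemma bounded_linear_coord: "bounded_linear (\<lambda>z. coord z i)"
  unfolding coord_def
  by (cases i) (auto intro!: bounded_linear_compose[OF bounded_linear_vec_nth] bounded_linear_fst bounded_linear_snd)

lemma hinfty_coord:
  assumes "holo_map Omega \<phi>" "\<phi> ` Omega \<subseteq> Omega"
  shows "hinfty (\<lambda>z. coord (\<phi> z) i)"
  unfolding hinfty_def holo_fun_def
proof (intro conjI ballI)
  fix z :: "('a, 'b) pt" assume z: "z \<in> Omega"
  then obtain D where D: "(\<phi> has_derivative D) (at z)" "\<And>x. D (cscale \<i> x) = cscale \<i> (D x)"
    using assms unfolding holo_map_def by metis
  have "coord (cscale \<i> w) i = \<i> * coord w i" for w :: "('a, 'b) pt"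
    by (simp add: coord_def cscale_def split: sum.split)
  then show "\<exists>D. ((\<lambda>z. coord (\<phi> z) i) has_derivative D) (at z) \<and> (\<forall>x. D (cscale \<i> x) = \<i> * D x)"
    using D bounded_linear.has_derivative[OF bounded_linear_coord[of i] D(1)]
    by (intro exI[of _ "\<lambda>x. coord (D x) i"]) simp
next
  have "cmod (coord (\<phi> z) i) \<le> 1" if "z \<in> Omega" for z
    using norm_coord_le[of "\<phi> z" i] assms(2) that by (force simp: Omega_iff)
  then show "\<exists>e. \<forall>z\<in>Omega. cmod (coord (\<phi> z) i) \<le> e" by blast
qed

lemma hinfty_lagrange:
  assumes "hinfty h"
  shows "hinfty (\<lambda>z. lagrange m j (h z))"
proof -
  have "hinfty (\<lambda>z. (h z - of_nat i) / (of_nat j - of_nat i))" for i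
    using hinfty_mult[OF hinfty_add[OF assms hinfty_const[of "- of_nat i"]] hinfty_const[of "1 / (of_nat j - of_nat i)"]]
    by simp
  then show ?thesis unfolding lagrange_def by (intro hinfty_prod)
qed

text \<open>The Taylor polynomial of \<open>f\<close> of degree below \<open>m\<close>, composed
  with \<open>\<phi>\<close> and written in interpolated form: \<open>f\<close> enters only through
  its values at grid nodes, \<open>z\<close> only through functions independent of \<open>f\<close>.
  The nodes may lie outside \<open>Omega\<close>, where \<open>hom_part\<close> still makes
  sense.\<close>

definition taylor_op :: "(('a::finite, 'b::finite) pt \<Rightarrow> ('a, 'b) pt) \<Rightarrow> nat \<Rightarrow> ('a, 'b) h2op" where
  "taylor_op \<phi> m f z = (\<Sum>\<nu>\<in>UNIV \<rightarrow>\<^sub>E {..<m}. (\<Prod>i\<in>UNIV. lagrange m (\<nu> i) (coord (\<phi> z) i)) *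
    (\<Sum>k<m. hom_part k f (of_coord (\<lambda>i. of_nat (\<nu> i)))))"

lemma taylor_op_eq:
  fixes f :: "('a::finite, 'b::finite) pt \<Rightarrow> complex"
  assumes "in_H2 f"
  shows "taylor_op \<phi> m f z = (\<Sum>k<m. hom_part k f (\<phi> z))"
proof -
  \<comment> \<open>Any positive radius below 1 serves here; the bound feeds
    \<open>taylor_line_polynomial\<close>.\<close>
  obtain C where C: "\<And>w. ptnorm w \<le> 1/2 \<Longrightarrow> cmod (f w) \<le> C * hardy_norm f"
    by (rule in_H2_point_bound[of "1/2", where 'a='a and 'b='b]) (use assms in auto)
  have f: "holo_fun Omega f" using assms by (simp add: in_H2_def)
  define F where "F = (\<lambda>h. \<Sum>k<m. hom_part k f (of_coord h))"
  have "\<exists>a. \<forall>c. F (h(i := c)) = (\<Sum>j<m. a j * c ^ j)" for h i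
  proof -
    have eq: "F (h(i := c)) = (\<Sum>k<m. hom_part k f (of_coord (h(i := 0)) + cscale c (of_coord ((\<lambda>_. 0)(i := 1)))))" for c
      by (simp only: F_def of_coord_upd[of h i c])
    show ?thesis
      unfolding eq by (rule taylor_line_polynomial[where \<rho>="1/2", OF f _ _ C]) auto
  qed
  from multivariate_lagrange_interpolation[of F m UNIV "coord (\<phi> z)", OF this]
  show ?thesis
    by (simp add: taylor_op_def F_def of_coord_coord)
qed

lemma taylor_op_rank:
  fixes \<phi> :: "('a::finite, 'b::finite) pt \<Rightarrow> ('a, 'b) pt"
  assumes \<phi>: "holo_map Omega \<phi>" "\<phi> ` Omega \<subseteq> Omega"
    and m: "m ^ (CARD('a) + CARD('b)) < n"
  shows "taylor_op \<phi> m \<in> rank_less n"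
proof -
  define N where "N = ((UNIV :: ('a + 'b) set) \<rightarrow>\<^sub>E {..<m})"
  define g where "g = (\<lambda>\<nu> z. \<Prod>i\<in>UNIV. lagrange m (\<nu> i) (coord (\<phi> z) i))"
  define b where "b = (\<lambda>f \<nu>. \<Sum>k<m. hom_part k f (of_coord (\<lambda>i. of_nat (\<nu> i)) :: ('a, 'b) pt))"
  have R: "taylor_op \<phi> m f z = (\<Sum>\<nu>\<in>N. g \<nu> z * b f \<nu>)" for f z
    by (simp add: taylor_op_def N_def g_def b_def)
  have N: "finite N" "card N = m ^ (CARD('a) + CARD('b))"
    by (simp_all add: N_def finite_PiE card_PiE)
  have g: "hinfty (g \<nu>)" for \<nu>
    unfolding g_def by (intro hinfty_prod hinfty_lagrange hinfty_coord \<phi>)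
  have "in_H2 (taylor_op \<phi> m f)" for f
    unfolding R[abs_def] by (intro hinfty_in_H2 hinfty_sum hinfty_mult g hinfty_const)
  moreover have "taylor_op \<phi> m f z = taylor_op \<phi> m h z" if "\<forall>z\<in>Omega. f z = h z" for f h z
  proof -
    have "b f \<nu> = b h \<nu>" for \<nu>
      unfolding b_def using that by (intro sum.cong refl hom_part_cong) blast
    then show ?thesis by (simp add: R)
  qed
  ultimately have "H2_map (taylor_op \<phi> m)"
    unfolding H2_map_def by blast
  moreover have "H2_linear (taylor_op \<phi> m)"
    unfolding H2_linear_def
  proof (intro allI impI ballI)
    fix f h :: "('a, 'b) pt \<Rightarrow> complex" and \<alpha> \<beta> :: complex and z :: "('a, 'b) pt"
    assume "in_H2 f" "in_H2 h"
    then have "b (\<lambda>w. \<alpha> * f w + \<beta> * h w) \<nu> = \<alpha> * b f \<nu> + \<beta> * b h \<nu>" for \<nu>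
      by (simp add: b_def hom_part_linear in_H2_def sum.distrib sum_distrib_left)
    then show "taylor_op \<phi> m (\<lambda>w. \<alpha> * f w + \<beta> * h w) z = \<alpha> * taylor_op \<phi> m f z + \<beta> * taylor_op \<phi> m h z"
      by (simp add: R sum.distrib sum_distrib_left algebra_simps)
  qed
  moreover have "\<exists>c. \<forall>z\<in>Omega. taylor_op \<phi> m f z = (\<Sum>h\<in>g ` N. c h * h z)" for f
  proof (intro exI ballI)
    fix z :: "('a, 'b) pt"
    \<comment> \<open>Different \<open>\<nu>\<close> may give the same function, so coefficients are
      added over the fibres of \<open>g\<close>.\<close>
    have "taylor_op \<phi> m f z = (\<Sum>h\<in>g ` N. \<Sum>\<nu>\<in>{\<nu>. \<nu> \<in> N \<and> g \<nu> = h}. g \<nu> z * b f \<nu>)"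
      unfolding R by (rule sum.image_gen[OF N(1)])
    also have "\<dots> = (\<Sum>h\<in>g ` N. (\<Sum>\<nu>\<in>{\<nu>. \<nu> \<in> N \<and> g \<nu> = h}. b f \<nu>) * h z)"
      by (intro sum.cong refl) (simp add: sum_distrib_left[symmetric] mult.commute)
    finally show "taylor_op \<phi> m f z = (\<Sum>h\<in>g ` N. (\<Sum>\<nu>\<in>{\<nu>. \<nu> \<in> N \<and> g \<nu> = h}. b f \<nu>) * h z)" .
  qed
  moreover have "card (g ` N) < n"
    using card_image_le[OF N(1), of g] N(2) m by simp
  ultimately show ?thesis
    unfolding rank_less_def using N(1) g hinfty_in_H2 by blast
qed

section \<open>Choice of the truncation degree and of the decay constants\<close>

theorem theorem5p2:
  fixes \<phi> :: "('a::finite, 'b::finite) pt \<Rightarrow> ('a, 'b) pt"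
  assumes "schur_map \<phi>"
    and "truly_d_dim \<phi>"
    and "compact_H2_op (comp_op \<phi>)"
    and "(SUP z\<in>Omega. max (norm (fst (\<phi> z))) (norm (snd (\<phi> z)))) < 1"
  shows "\<exists>c C. 0 < c \<and> c \<le> C \<and>
    (\<forall>n::nat. n \<ge> 1 \<longrightarrow>
       approx_num (comp_op \<phi>) n
         \<le> ereal (C * exp (- c * real n powr (1 / real (CARD('a) + CARD('b))))))"
proof -
  have \<phi>: "holo_map Omega \<phi>" "\<phi> ` Omega \<subseteq> Omega"
    using assms(1) by (auto simp: schur_map_def)
  define T where "T = max (1/2) (SUP z\<in>Omega. ptnorm (\<phi> z))"
  have "bdd_above ((\<lambda>z. ptnorm (\<phi> z)) ` Omega)"
    using \<phi>(2) by (intro bdd_aboveI2[of _ _ 1]) (force simp: Omega_iff)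
  then have \<phi>T: "ptnorm (\<phi> z) \<le> T" if "z \<in> Omega" for z
    using cSUP_upper[OF that] by (auto simp: T_def le_max_iff_disj)
  have T: "0 < T" "T < 1"
    using assms(4) by (auto simp: T_def ptnorm_def)
  then obtain \<rho> where \<rho>: "T < \<rho>" "\<rho> < 1" using dense by blast
  obtain K where K: "0 \<le> K" "\<And>f w. in_H2 (f :: ('a, 'b) pt \<Rightarrow> complex) \<Longrightarrow> ptnorm w \<le> \<rho> \<Longrightarrow> cmod (f w) \<le> K * hardy_norm f"
    using in_H2_point_bound[of \<rho>] T \<rho> by (metis less_trans)
  define \<theta> where "\<theta> = T / \<rho>"
  have \<theta>: "0 < \<theta>" "\<theta> < 1" using T \<rho> by (auto simp: \<theta>_def)
  define d where "d = CARD('a) + CARD('b)"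
  have d: "0 < d" by (simp add: d_def)
  \<comment> \<open>\<open>\<theta> ^ m\<close> decays like \<open>exp (- c * m)\<close>. In
    \<open>C\<close> the factor \<open>1 / \<theta>\<close> pays for rounding \<open>x\<close> down
    to \<open>m\<close>, and the maximum ensures \<open>c \<le> C\<close>.\<close>
  define c where "c = - ln \<theta>"
  define C where "C = max c (K / (1 - \<theta>) / \<theta>)"
  have c: "0 < c" using \<theta> by (simp add: c_def)
  have "approx_num (comp_op \<phi>) n \<le> ereal (C * exp (- c * real n powr (1 / real d)))" if n: "n \<ge> 1" for n
  proof -
    define x where "x = real n powr (1 / real d)"
    have x: "0 < x" using n by (simp add: x_def)
    \<comment> \<open>The largest natural number strictly below \<open>x\<close>: strictness gives
      \<open>m ^ d < n\<close>, as \<open>rank_less n\<close> demands. For \<open>n = 1\<close> it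
      is 0 and the approximant is the zero operator.\<close>
    define m where "m = nat (\<lceil>x\<rceil> - 1)"
    have m: "real m < x" "x \<le> real m + 1"
      using x by (auto simp: m_def) linarith+
    have "real m ^ d < x ^ d"
      using m d by (intro power_strict_mono) auto
    also have "x ^ d = real n"
      using n d by (simp add: x_def powr_realpow[symmetric] powr_powr)
    finally have "m ^ d < n"
      by (simp only: of_nat_power[symmetric] of_nat_less_iff)
    then have rank: "taylor_op \<phi> m \<in> rank_less n"
      using \<phi> by (intro taylor_op_rank) (simp_all add: d_def)
    have "op_norm (\<lambda>f z. comp_op \<phi> f z - taylor_op \<phi> m f z) \<le> ereal (K * \<theta> ^ m / (1 - \<theta>))"
      unfolding op_norm_def
    proof (rule SUP_least)
      fix f :: "('a, 'b) pt \<Rightarrow> complex" assume "f \<in> {f. in_H2 f \<and> hardy_norm f \<le> 1}"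
      then have f: "in_H2 f" "hardy_norm f \<le> 1" by auto
      \<comment> \<open>This bound is uniform over the unit ball of the Hardy space, so the tail
        estimate passes to the operator norm.\<close>
      have bd: "cmod (f w) \<le> K" if "ptnorm w \<le> \<rho>" for w
        using K(2)[OF f(1) that] mult_left_mono[OF f(2) K(1)] by simp
      have "cmod (comp_op \<phi> f z - taylor_op \<phi> m f z) \<le> K * \<theta> ^ m / (1 - \<theta>)" if "z \<in> Omega" for z
        using taylor_tail_le[where f=f and m=m, OF _ _ \<rho>(2) bd \<phi>T[OF that] T(1) \<rho>(1)] f(1) T \<rho>
        by (simp add: taylor_op_eq[OF f(1)] comp_op_def \<theta>_def in_H2_def)
      then show "ereal (hardy_norm (\<lambda>z. comp_op \<phi> f z - taylor_op \<phi> m f z)) \<le> ereal (K * \<theta> ^ m / (1 - \<theta>))"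
        using K \<theta> by (auto intro!: hardy_norm_le)
    qed
    also have "K * \<theta> ^ m / (1 - \<theta>) \<le> C * exp (- c * x)"
    proof -
      have "\<theta> ^ m = \<theta> powr (real m)" using \<theta> by (simp add: powr_realpow)
      also have "\<dots> \<le> \<theta> powr (x - 1)"
        using m \<theta> by (intro powr_mono') auto
      also have "\<dots> = exp (- c * x) / \<theta>"
        using \<theta> by (simp add: powr_def c_def right_diff_distrib exp_diff mult.commute)
      finally have "K / (1 - \<theta>) * \<theta> ^ m \<le> K / (1 - \<theta>) * (exp (- c * x) / \<theta>)"
        using K \<theta> by (intro mult_left_mono) auto
      also have "\<dots> \<le> C * exp (- c * x)"
        by (simp add: C_def max_mult_distrib_right)
      finally show ?thesis by simp
    qed
    finally have "op_norm (\<lambda>f z. comp_op \<phi> f z - taylor_op \<phi> m f z) \<le> ereal (C * exp (- c * x))" by simp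
    then show ?thesis
      unfolding approx_num_def x_def by (rule INF_lower2[OF rank])
  qed
  then show ?thesis
    using c by (intro exI[of _ c] exI[of _ C]) (simp add: C_def d_def)
qed

end
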